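(* Let $T$ be a tree. Then $\rho_e^o(T)=\nu_I(T)$ if and only if $T\in\mathcal{F}\cup\{P_1,P_2\}$ (up to isomorphism).
   Context: All graphs are finite and simple. A matching $M$ of a graph $G$ is an induced matching if no two distinct edges of $M$ are joined by an edge of $G$; $\nu_I(G)$ denotes the maximum cardinality of an induced matching in $G$. A set $B\subseteq E(G)$ is an edge open packing set (EOP set) if for any two distinct edges $e_1,e_2\in B$ there is no edge $e\in E(G)\setminus\{e_1,e_2\}$ joining an endvertex of $e_1$ to an endvertex of $e_2$ (that is, no edge $e$ such that $e_1,e,e_2$ form a path with middle edge $e$ or a triangle). Edges of $B$ may share an endvertex. The maximum cardinality of an EOP set is the EOP number $\rho_e^o(G)$. $P_n$ is the path on $n$ vertices. For $k\ge 1$, the spider $S^k$ with $k$ legs is the tree obtained from the star $K_{1,k}$ with center $v$ by subdividing each edge exactly once; $v$ is called the center of $S^k$. (Equivalently, it is obtained from $k$ disjoint copies of $P_2$ by joining a new vertex $v$ to exactly one leaf of each copy.) For a tree $S$, $L(S)$ denotes its set of leaves. The family $\mathcal{F}$ consists of all trees $T=T(k_1,\ldots,k_n)$, $n\ge 1$, obtained from the disjoint union of $n$ spiders $S_1=S^{k_1},\ldots,S_n=S^{k_n}$, with $k_i\ge 2$ for each $i\in\{1,\ldots,n\}$ and with centers $v_1,\ldots,v_n$ respectively, by adding $n-1$ edges $e_1,\ldots,e_{n-1}$ (so that the result is a tree) such that: (C1) for every $i\in\{1,\ldots,n-1\}$, $e_i$ has an endvertex in $\{v_1,\ldots,v_n\}$;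 and (C2) for every $i\in\{1,\ldots,n\}$ there exist at least two vertices $x,y\in L(S_i)$ with $\deg_T(x)=\deg_T(y)=1$. *)

theory Defs
  imports Main
begin

section \<open>Finite simple graphs\<close>

type_synonym 'a ugraph = "'a set \<times> 'a set set"

abbreviation gverts :: "'a ugraph \<Rightarrow> 'a set" where "gverts G \<equiv> fst G"
abbreviation gedges :: "'a ugraph \<Rightarrow> 'a set set" where "gedges G \<equiv> snd G"

definition simple_graph :: "'a ugraph \<Rightarrow> bool" where
  "simple_graph G \<longleftrightarrow> finite (gverts G) \<and> (\<forall>e\<in>gedges G. e \<subseteq> gverts G \<and> card e = 2)"

definition gdegree :: "'a ugraph \<Rightarrow> 'a \<Rightarrow> nat" where
  "gdegree G v = card {e \<in> gedges G. v \<in> e}"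

definition gleaves :: "'a ugraph \<Rightarrow> 'a set" where
  "gleaves G = {v \<in> gverts G. gdegree G v = 1}"

definition adj_rel :: "'a ugraph \<Rightarrow> ('a \<times> 'a) set" where
  "adj_rel G = {(u, v). {u, v} \<in> gedges G}"

text \<open>The graph without vertices does not count as connected, hence not as a tree.\<close>

definition connected_graph :: "'a ugraph \<Rightarrow> bool" where
  "connected_graph G \<longleftrightarrow>
     gverts G \<noteq> {} \<and> (\<forall>u\<in>gverts G. \<forall>v\<in>gverts G. (u, v) \<in> (adj_rel G)\<^sup>*)"

definition graph_cycle :: "'a ugraph \<Rightarrow> 'a list \<Rightarrow> bool" where
  "graph_cycle G c \<longleftrightarrow>
     length c \<ge> 3 \<and> distinct c \<and>
     (\<forall>i. Suc i < length c \<longrightarrow> {c ! i, c ! Suc i} \<in> gedges G) \<and>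
     {last c, hd c} \<in> gedges G"

definition tree_graph :: "'a ugraph \<Rightarrow> bool" where
  "tree_graph G \<longleftrightarrow> simple_graph G \<and> connected_graph G \<and> (\<nexists>c. graph_cycle G c)"

definition graph_iso :: "'a ugraph \<Rightarrow> 'b ugraph \<Rightarrow> bool" (infix \<open>\<simeq>\<^sub>g\<close> 50) where
  "G \<simeq>\<^sub>g H \<longleftrightarrow>
     (\<exists>f. bij_betw f (gverts G) (gverts H) \<and>
          (\<forall>u\<in>gverts G. \<forall>v\<in>gverts G. {u, v} \<in> gedges G \<longleftrightarrow> {f u, f v} \<in> gedges H))"

definition path_graph :: "nat \<Rightarrow> nat ugraph" where
  "path_graph n = ({..<n}, {{i, Suc i} | i. Suc i < n})"


section \<open>Induced matchings and edge open packings\<close>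

definition edge_joins :: "'a set \<Rightarrow> 'a set \<Rightarrow> 'a set \<Rightarrow> bool" where
  "edge_joins e e\<^sub>1 e\<^sub>2 \<longleftrightarrow> (\<exists>x\<in>e\<^sub>1. \<exists>y\<in>e\<^sub>2. e = {x, y})"

definition graph_matching :: "'a ugraph \<Rightarrow> 'a set set \<Rightarrow> bool" where
  "graph_matching G M \<longleftrightarrow>
     M \<subseteq> gedges G \<and> (\<forall>e\<^sub>1\<in>M. \<forall>e\<^sub>2\<in>M. e\<^sub>1 \<noteq> e\<^sub>2 \<longrightarrow> e\<^sub>1 \<inter> e\<^sub>2 = {})"

definition induced_matching :: "'a ugraph \<Rightarrow> 'a set set \<Rightarrow> bool" where
  "induced_matching G M \<longleftrightarrow>
     graph_matching G M \<and>
     (\<forall>e\<^sub>1\<in>M. \<forall>e\<^sub>2\<in>M. e\<^sub>1 \<noteq> e\<^sub>2 \<longrightarrow> \<not> (\<exists>e\<in>gedges G. edge_joins e e\<^sub>1 e\<^sub>2))"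

definition induced_matching_number :: "'a ugraph \<Rightarrow> nat" (\<open>\<nu>\<^sub>I\<close>) where
  "\<nu>\<^sub>I G = Max (card ` {M. induced_matching G M})"

text \<open>
  The edges of an edge open packing set may share an endvertex, and the joining edge may itself
  belong to the set.
\<close>

definition eop_set :: "'a ugraph \<Rightarrow> 'a set set \<Rightarrow> bool" where
  "eop_set G B \<longleftrightarrow>
     B \<subseteq> gedges G \<and>
     (\<forall>e\<^sub>1\<in>B. \<forall>e\<^sub>2\<in>B. e\<^sub>1 \<noteq> e\<^sub>2 \<longrightarrow> \<not> (\<exists>e\<in>gedges G - {e\<^sub>1, e\<^sub>2}. edge_joins e e\<^sub>1 e\<^sub>2))"

definition eop_number :: "'a ugraph \<Rightarrow> nat" (\<open>\<rho>\<^sub>e\<^sup>o\<close>) where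
  "\<rho>\<^sub>e\<^sup>o G = Max (card ` {B. eop_set G B})"


section \<open>Spiders and the family F\<close>

text \<open>
  \<open>Mid i\<close> is the vertex subdividing the \<open>i\<close>-th edge of the star and \<open>Tip i\<close> the corresponding
  leaf of the star.
\<close>

datatype spider_vertex = Center | Mid nat | Tip nat

definition spider :: "nat \<Rightarrow> spider_vertex ugraph" where
  "spider k =
     ({Center} \<union> Mid ` {..<k} \<union> Tip ` {..<k},
      {{Center, Mid i} | i. i < k} \<union> {{Mid i, Tip i} | i. i < k})"

definition disjoint_union_graph :: "'i set \<Rightarrow> ('i \<Rightarrow> 'a ugraph) \<Rightarrow> ('i \<times> 'a) ugraph" where
  "disjoint_union_graph I G =
     (SIGMA i:I. gverts (G i), \<Union>i\<in>I. (\<lambda>e. Pair i ` e) ` gedges (G i))"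

definition add_edges :: "'a ugraph \<Rightarrow> 'a set set \<Rightarrow> 'a ugraph" where
  "add_edges G A = (gverts G, gedges G \<union> A)"

text \<open>
  Concrete representatives of the family: the vertex \<open>x\<close> of the \<open>i\<close>-th spider is \<open>(i, x)\<close>, and
  \<open>A\<close> is the set of the \<open>n - 1\<close> added edges.
\<close>

definition family_F :: "(nat \<times> spider_vertex) ugraph set" where
  "family_F =
     {T. \<exists>(n::nat) (k::nat \<Rightarrow> nat) A.
        n \<ge> 1 \<and>
        (\<forall>i\<in>{1..n}. k i \<ge> 2) \<and>
        T = add_edges (disjoint_union_graph {1..n} (\<lambda>i. spider (k i))) A \<and>
        finite A \<and> card A = n - 1 \<and>
        A \<inter> gedges (disjoint_union_graph {1..n} (\<lambda>i. spider (k i))) = {} \<and>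
        tree_graph T \<and>
        (\<forall>e\<in>A. \<exists>i\<in>{1..n}. (i, Center) \<in> e) \<and>
        (\<forall>i\<in>{1..n}. \<exists>x\<in>gleaves (spider (k i)). \<exists>y\<in>gleaves (spider (k i)).
           x \<noteq> y \<and> gdegree T (i, x) = 1 \<and> gdegree T (i, y) = 1)}"

end

(*
  Let M be a maximum induced matching of a tree T and suppose that no edge open packing is larger
  than M. All edges of T outside M meet the set C of vertices not covered by M, so C should consist
  of the spider centers and M of the edges at their leaves. At v in C with a covered neighbour y,
  the edge vy together with M gives a larger packing, unless in the branch of T - v at some other
  neighbour x every packing as large as M restricted to that branch uses x. Exchanging edges of M
  for a star shows that such an x lies on an edge xx' of M with x' a leaf of T; hence every v in C
  sees at least two legs of this kind. A root decides which center gets a leg wanted by several,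
  and counting edges gives n - 1 edges outside the spiders.

  Conversely, in a member of the family each edge of a packing has an endvertex private to it;
  charging the edge to the leg at this vertex, or to a leaf leg of its own if the vertex is
  a center, is injective. So no packing is larger than the induced matching formed by the legs.
*)

theory Submission
  imports Defs
begin

text \<open>The packing in the branch at \<open>x\<close> has to avoid \<open>x\<close> because
  \<open>vx\<close> is the only edge from \<open>v\<close> into that branch: packings that avoid the
  neighbours of \<open>v\<close> combine freely with each other and with a star edge
  \<open>vy\<close>. This leads to two local notions. A neighbour is freeable if avoiding it costs
  nothing; a vertex set is gainful if it holds a packing larger than the part of \<open>M\<close>
  inside it. Two legs come from one argument used twice: a neighbour that cannot be freed is
  covered, so it can itself take the role of \<open>y\<close>, and this produces a second one. The
  obstacle is that a leg may be adjacent to several centers, so that their claims collide. The whole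
  tree and a branch both consist of a vertex and some of the branches at it, so the argument also
  works inside a branch; there it shows that a center with a contested claim has two further claims.
  The two paths are the degenerate cases: \<open>P_1\<close> is a center without legs, and in
  \<open>P_2\<close> the matching leaves no center.\<close>

section \<open>Edges of simple graphs\<close>

lemma simple_graph_finite_edges: "simple_graph G \<Longrightarrow> finite (gedges G)"
  unfolding simple_graph_def by (meson PowI finite_Pow_iff finite_subset subsetI)

lemma simple_graph_adj_neq: "simple_graph G \<Longrightarrow> {u, v} \<in> gedges G \<Longrightarrow> u \<noteq> v"
  unfolding simple_graph_def by force

lemma simple_graph_adj_verts:
  "simple_graph G \<Longrightarrow> {u, v} \<in> gedges G \<Longrightarrow> u \<in> gverts G \<and> v \<in> gverts G"
  unfolding simple_graph_def by blast

lemma simple_graph_edgeE: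
  assumes "simple_graph G" "e \<in> gedges G"
  obtains u v where "e = {u, v}" "u \<noteq> v"
  using assms unfolding simple_graph_def by (meson card_2_iff)

lemma simple_graph_edge_eq:
  assumes "simple_graph G" "e \<in> gedges G" "u \<in> e" "v \<in> e" "u \<noteq> v"
  shows "e = {u, v}"
  using simple_graph_edgeE[OF assms(1,2)] assms(3-5) by blast

lemma simple_graph_edge_other:
  assumes "simple_graph G" "e \<in> gedges G" "u \<in> e"
  obtains v where "e = {u, v}" "u \<noteq> v"
  using simple_graph_edgeE[OF assms(1,2)] assms(3) by blast

section \<open>Edge open packings and induced matchings\<close>

lemma eop_setI:
  assumes "B \<subseteq> gedges G"
    and "\<And>e\<^sub>1 e\<^sub>2 x y. \<lbrakk>e\<^sub>1 \<in> B; e\<^sub>2 \<in> B; e\<^sub>1 \<noteq> e\<^sub>2; x \<in> e\<^sub>1; y \<in> e\<^sub>2; {x, y} \<in> gedges G\<rbrakk>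
      \<Longrightarrow> {x, y} = e\<^sub>1 \<or> {x, y} = e\<^sub>2"
  shows "eop_set G B"
  using assms unfolding eop_set_def edge_joins_def by blast

lemma eop_setD:
  assumes "eop_set G B" "e\<^sub>1 \<in> B" "e\<^sub>2 \<in> B" "e\<^sub>1 \<noteq> e\<^sub>2" "x \<in> e\<^sub>1" "y \<in> e\<^sub>2" "{x, y} \<in> gedges G"
  shows "{x, y} = e\<^sub>1 \<or> {x, y} = e\<^sub>2"
  using assms unfolding eop_set_def edge_joins_def by blast

lemma induced_matching_iff:
  "induced_matching G M \<longleftrightarrow> M \<subseteq> gedges G \<and>
     (\<forall>e\<^sub>1\<in>M. \<forall>e\<^sub>2\<in>M. e\<^sub>1 \<noteq> e\<^sub>2 \<longrightarrow> e\<^sub>1 \<inter> e\<^sub>2 = {} \<and> (\<forall>x\<in>e\<^sub>1. \<forall>y\<in>e\<^sub>2. {x, y} \<notin> gedges G))"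
proof -
  have "(\<exists>e\<in>gedges G. edge_joins e e\<^sub>1 e\<^sub>2) \<longleftrightarrow> (\<exists>x\<in>e\<^sub>1. \<exists>y\<in>e\<^sub>2. {x, y} \<in> gedges G)"
    for e\<^sub>1 e\<^sub>2 unfolding edge_joins_def by blast
  then show ?thesis
    unfolding induced_matching_def graph_matching_def
    by (simp add: imp_conjR ball_conj_distrib conj_assoc)
qed

lemma induced_matching_unique:
  "\<lbrakk>induced_matching G M; m \<in> M; m' \<in> M; x \<in> m; x \<in> m'\<rbrakk> \<Longrightarrow> m' = m"
  unfolding induced_matching_iff by (metis disjoint_iff)

lemma induced_matching_adj:
  "\<lbrakk>induced_matching G M; m \<in> M; m' \<in> M; x \<in> m; y \<in> m'; {x, y} \<in> gedges G\<rbrakk> \<Longrightarrow> m' = m"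
  unfolding induced_matching_iff by metis

lemma induced_matching_imp_eop_set: "induced_matching G M \<Longrightarrow> eop_set G M"
  by (rule eop_setI) (metis induced_matching_iff)+

lemma induced_matching_subset: "induced_matching G M \<Longrightarrow> N \<subseteq> M \<Longrightarrow> induced_matching G N"
  unfolding induced_matching_iff by (meson subset_iff)

lemma eop_set_finite: "simple_graph G \<Longrightarrow> eop_set G B \<Longrightarrow> finite B"
  by (meson eop_set_def finite_subset simple_graph_finite_edges)

lemma finite_Collect_eop_set: "simple_graph G \<Longrightarrow> finite {B. eop_set G B}"
  by (rule finite_subset[of _ "Pow (gedges G)"])
    (simp_all add: Collect_mono_iff Pow_def eop_set_def simple_graph_finite_edges)

lemma finite_Collect_induced_matching: "simple_graph G \<Longrightarrow> finite {M. induced_matching G M}"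
  by (rule finite_subset[of _ "{B. eop_set G B}"])
    (auto simp: induced_matching_imp_eop_set finite_Collect_eop_set)

lemma card_le_eop_number: "simple_graph G \<Longrightarrow> eop_set G B \<Longrightarrow> card B \<le> \<rho>\<^sub>e\<^sup>o G"
  unfolding eop_number_def by (rule Max_ge) (auto simp: finite_Collect_eop_set)

lemma card_le_induced_matching_number:
  "simple_graph G \<Longrightarrow> induced_matching G M \<Longrightarrow> card M \<le> \<nu>\<^sub>I G"
  unfolding induced_matching_number_def
  by (rule Max_ge) (auto simp: finite_Collect_induced_matching)

lemma eop_number_attained:
  assumes "simple_graph G"
  obtains B where "eop_set G B" "card B = \<rho>\<^sub>e\<^sup>o G"
proof -
  have "eop_set G {}" by (simp add: eop_set_def)
  then have "\<rho>\<^sub>e\<^sup>o G \<in> card ` {B. eop_set G B}"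
    unfolding eop_number_def using finite_Collect_eop_set[OF assms] by (intro Max_in) auto
  then show ?thesis using that by auto
qed

lemma induced_matching_number_attained:
  assumes "simple_graph G"
  obtains M where "induced_matching G M" "card M = \<nu>\<^sub>I G"
proof -
  have "induced_matching G {}" by (simp add: induced_matching_iff)
  then have "\<nu>\<^sub>I G \<in> card ` {M. induced_matching G M}"
    unfolding induced_matching_number_def using finite_Collect_induced_matching[OF assms]
    by (intro Max_in) auto
  then show ?thesis using that by auto
qed

lemma induced_matching_number_le_eop_number: "simple_graph G \<Longrightarrow> \<nu>\<^sub>I G \<le> \<rho>\<^sub>e\<^sup>o G"
  by (metis card_le_eop_number induced_matching_imp_eop_set induced_matching_number_attained)

lemma eop_set_Un:
  assumes "eop_set G A" "eop_set G B" "\<And>a b. a \<in> \<Union>A \<Longrightarrow> b \<in> \<Union>B \<Longrightarrow> {a, b} \<notin> gedges G"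
  shows "eop_set G (A \<union> B)"
proof (rule eop_setI)
  show "A \<union> B \<subseteq> gedges G" using assms(1,2) by (auto simp: eop_set_def)
next
  fix e\<^sub>1 e\<^sub>2 x y
  assume *: "e\<^sub>1 \<in> A \<union> B" "e\<^sub>2 \<in> A \<union> B" "e\<^sub>1 \<noteq> e\<^sub>2" "x \<in> e\<^sub>1" "y \<in> e\<^sub>2" "{x, y} \<in> gedges G"
  then have "{y, x} \<in> gedges G" by (simp add: insert_commute)
  with * assms(3) have "e\<^sub>1 \<in> A \<and> e\<^sub>2 \<in> A \<or> e\<^sub>1 \<in> B \<and> e\<^sub>2 \<in> B" by blast
  with * show "{x, y} = e\<^sub>1 \<or> {x, y} = e\<^sub>2" using eop_setD assms(1,2) by metis
qed

text \<open>The separation hypothesis already makes \<open>A\<close> and \<open>B\<close> disjoint: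
  a common edge \<open>{u, v}\<close> would itself join \<open>u\<close> in \<open>\<Union>A\<close>
  to \<open>v\<close> in \<open>\<Union>B\<close>.\<close>

lemma card_eop_set_Un:
  assumes G: "simple_graph G"
    and AB: "eop_set G A" "eop_set G B" "\<And>a b. a \<in> \<Union>A \<Longrightarrow> b \<in> \<Union>B \<Longrightarrow> {a, b} \<notin> gedges G"
  shows "card (A \<union> B) = card A + card B"
proof -
  have "A \<inter> B = {}"
  proof (rule ccontr)
    assume "A \<inter> B \<noteq> {}"
    then obtain e where e: "e \<in> A" "e \<in> B" by blast
    then have "e \<in> gedges G" using AB(1) by (auto simp: eop_set_def)
    then obtain u v where "e = {u, v}" using simple_graph_edgeE[OF G] by metis
    with e AB(3)[of u v] \<open>e \<in> gedges G\<close> show False by blast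
  qed
  then show ?thesis using eop_set_finite[OF G] AB(1,2) by (simp add: card_Un_disjoint)
qed

lemma eop_set_UN:
  assumes G: "simple_graph G" and "finite X"
    and "\<And>x. x \<in> X \<Longrightarrow> eop_set G (B x)"
    and "\<And>x y a b. \<lbrakk>x \<in> X; y \<in> X; x \<noteq> y; a \<in> \<Union>(B x); b \<in> \<Union>(B y)\<rbrakk> \<Longrightarrow> {a, b} \<notin> gedges G"
  shows "eop_set G (\<Union>x\<in>X. B x) \<and> card (\<Union>x\<in>X. B x) = (\<Sum>x\<in>X. card (B x))"
  using assms(2-)
proof (induction X)
  case empty
  then show ?case by (simp add: eop_set_def)
next
  case (insert x X)
  have IH: "eop_set G (\<Union>x\<in>X. B x)" "card (\<Union>x\<in>X. B x) = (\<Sum>x\<in>X. card (B x))"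
    using insert by (metis insertCI)+
  have sep: "{a, b} \<notin> gedges G" if "a \<in> \<Union>(B x)" "b \<in> \<Union>(\<Union>x\<in>X. B x)" for a b
  proof -
    from that(2) obtain y where "y \<in> X" "b \<in> \<Union>(B y)" by blast
    then show ?thesis using insert.prems(2)[of x y a b] insert.hyps(2) that(1) by auto
  qed
  have Bx: "eop_set G (B x)" using insert.prems(1) by blast
  show ?case
    using eop_set_Un[OF Bx IH(1)] card_eop_set_Un[OF G Bx IH(1)] sep insert.hyps IH(2) by simp
qed

text \<open>Replacing the edges of \<open>M\<close> that meet the neighbourhood of an uncovered vertex \<open>u\<close> by the star
  at \<open>u\<close> loses nothing, because every such edge is paid for by its endvertex adjacent to \<open>u\<close>.\<close>

lemma eop_set_star_exchange:
  assumes G: "simple_graph G" and M: "induced_matching G M" and u: "u \<notin> \<Union>M"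
    and tri: "\<And>x y. {u, x} \<in> gedges G \<Longrightarrow> {u, y} \<in> gedges G \<Longrightarrow> {x, y} \<notin> gedges G"
    and Z: "Z \<subseteq> {z. {u, z} \<in> gedges G}" "{z \<in> \<Union>M. {u, z} \<in> gedges G} \<subseteq> Z"
    and pend: "\<And>z y. z \<in> Z \<Longrightarrow> z \<notin> \<Union>M \<Longrightarrow> y \<in> \<Union>M \<Longrightarrow> {z, y} \<notin> gedges G"
  defines "B \<equiv> {m \<in> M. \<forall>z\<in>m. {u, z} \<notin> gedges G} \<union> (\<lambda>z. {u, z}) ` Z"
  shows "eop_set G B" "card M + card (Z - \<Union>M) \<le> card B"
proof -
  let ?N = "{m \<in> M. \<forall>z\<in>m. {u, z} \<notin> gedges G}"
  have ME: "M \<subseteq> gedges G" using M by (simp add: induced_matching_iff)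
  \<comment> \<open>The situation is contradictory. \<open>x = u\<close> fails because
    \<open>m\<close> avoids the neighbours of \<open>u\<close>. If \<open>x = z\<close>, then
    \<open>z\<close> is covered by \<open>pend\<close>, so \<open>M\<close> being induced puts
    \<open>z\<close> on \<open>m\<close>, although \<open>z\<close> is a neighbour of
    \<open>u\<close>.\<close>
  have cross: "{x, y} = {u, z}"
    if z: "z \<in> Z" and m: "m \<in> ?N" "y \<in> m" and x: "x \<in> {u, z}" and xy: "{x, y} \<in> gedges G"
    for x y z m
  proof -
    have mM: "m \<in> M" and nadj: "\<And>w. w \<in> m \<Longrightarrow> {u, w} \<notin> gedges G" using m(1) by simp_all
    have yM: "y \<in> \<Union>M" using mM m(2) by (rule UnionI)
    have xz: "x = z" using x xy nadj[OF m(2)] by auto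
    then have "z \<in> \<Union>M" using pend[OF z _ yM] xy by metis
    then obtain m' where m': "m' \<in> M" "z \<in> m'" by (rule UnionE)
    then have "m = m'" using induced_matching_adj[OF M m'(1) mM m'(2) m(2)] xy xz by simp
    moreover have "{u, z} \<in> gedges G" using z Z(1) by (simp add: subset_iff)
    ultimately show ?thesis using nadj[of z] m'(2) by simp
  qed
  show "eop_set G B"
  proof (rule eop_setI)
    show "B \<subseteq> gedges G" using ME Z(1) by (auto simp: B_def)
  next
    fix e\<^sub>1 e\<^sub>2 x y
    assume *: "e\<^sub>1 \<in> B" "e\<^sub>2 \<in> B" "e\<^sub>1 \<noteq> e\<^sub>2" "x \<in> e\<^sub>1" "y \<in> e\<^sub>2" "{x, y} \<in> gedges G"
    have yx: "{y, x} \<in> gedges G" using *(6) by (simp add: insert_commute)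
    have "e \<in> ?N \<or> (\<exists>z\<in>Z. e = {u, z})" if "e \<in> B" for e using that unfolding B_def by auto
    then consider "e\<^sub>1 \<in> ?N" "e\<^sub>2 \<in> ?N" | z where "e\<^sub>1 = {u, z}" "z \<in> Z" "e\<^sub>2 \<in> ?N"
      | z where "e\<^sub>2 = {u, z}" "z \<in> Z" "e\<^sub>1 \<in> ?N"
      | z z' where "e\<^sub>1 = {u, z}" "e\<^sub>2 = {u, z'}" "z \<in> Z" "z' \<in> Z"
      using *(1,2) by meson
    then show "{x, y} = e\<^sub>1 \<or> {x, y} = e\<^sub>2"
    proof cases
      case 1
      then show ?thesis using induced_matching_adj[OF M _ _ *(4,5,6)] *(3) by simp
    next
      case 2
      then show ?thesis using cross[OF 2(2,3) *(5) _ *(6)] *(4) by simp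
    next
      case 3
      then show ?thesis using cross[OF 3(2,3) *(4) _ yx] *(5) by (simp add: insert_commute)
    next
      case 4
      then have "{u, z} \<in> gedges G" "{u, z'} \<in> gedges G" using Z(1) by (simp_all add: subset_iff)
      then show ?thesis
        using 4(1,2) *(4-6) tri[of z z'] simple_graph_adj_neq[OF G *(6)] by (auto simp: insert_commute)
    qed
  qed
  have fM: "finite M" using ME simple_graph_finite_edges[OF G] finite_subset by blast
  have "Z \<subseteq> gverts G" using Z(1) simple_graph_adj_verts[OF G] by blast
  then have fZ: "finite Z" using G finite_subset unfolding simple_graph_def by blast
  have "\<forall>m\<in>M - ?N. \<exists>z. z \<in> m \<and> {u, z} \<in> gedges G" by auto
  then obtain p where p: "m \<in> M - ?N \<Longrightarrow> p m \<in> m \<and> {u, p m} \<in> gedges G" for m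
    by (rule bchoice[elim_format]) meson
  have "inj_on p (M - ?N)"
  proof (rule inj_onI)
    fix m m' assume "m \<in> M - ?N" "m' \<in> M - ?N" "p m = p m'"
    then show "m = m'"
      using induced_matching_unique[OF M, of m' m "p m"] p[of m] p[of m'] by auto
  qed
  moreover have "p ` (M - ?N) \<subseteq> Z \<inter> \<Union>M"
  proof (rule image_subsetI)
    fix m assume "m \<in> M - ?N"
    then show "p m \<in> Z \<inter> \<Union>M" using p[of m] subsetD[OF Z(2), of "p m"] by auto
  qed
  ultimately have "card (M - ?N) \<le> card (Z \<inter> \<Union>M)" using fZ card_inj_on_le by blast
  moreover have "card M = card ?N + card (M - ?N)"
    using fM by (metis (no_types, lifting) card_Int_Diff Int_absorb1 mem_Collect_eq subsetI)
  moreover have "card Z = card (Z \<inter> \<Union>M) + card (Z - \<Union>M)" by (rule card_Int_Diff[OF fZ])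
  moreover have "card B = card ?N + card ((\<lambda>z. {u, z}) ` Z)"
    unfolding B_def using u fM fZ by (intro card_Un_disjoint) auto
  moreover have "card ((\<lambda>z. {u, z}) ` Z) = card Z"
    by (rule card_image) (auto simp: inj_on_def doubleton_eq_iff)
  ultimately show "card M + card (Z - \<Union>M) \<le> card B" by linarith
qed

section \<open>Branches of a tree\<close>

text \<open>Supplies the repetition-free path that \<open>branch_disjoint\<close> closes to a
  cycle.\<close>

lemma rtrancl_distinct_path:
  assumes "(x, y) \<in> r\<^sup>*"
  obtains xs where "xs \<noteq> []" "hd xs = x" "last xs = y" "distinct xs"
    "successively (\<lambda>a b. (a, b) \<in> r) xs"
proof -
  have "\<exists>xs. xs \<noteq> [] \<and> hd xs = x \<and> last xs = y \<and> distinct xs \<and> successively (\<lambda>a b. (a, b) \<in> r) xs"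
    using assms
  proof induction
    case base
    show ?case by (rule exI[of _ "[x]"]) simp
  next
    case (step y z)
    then obtain xs where xs: "xs \<noteq> []" "hd xs = x" "last xs = y" "distinct xs"
      "successively (\<lambda>a b. (a, b) \<in> r) xs" by blast
    show ?case
    proof (cases "z \<in> set xs")
      case True
      \<comment> \<open>The walk returns to \<open>z\<close>, so it is cut off at the earlier
        visit.\<close>
      then obtain as bs where "xs = as @ z # bs" by (meson split_list)
      then show ?thesis using xs
        by (intro exI[of _ "as @ [z]"]) (auto simp: successively_append_iff hd_append split: if_splits)
    next
      case False
      then show ?thesis using xs step.hyps(2)
        by (intro exI[of _ "xs @ [z]"]) (auto simp: successively_append_iff)
    qed
  qed
  then show ?thesis using that by blast
qed

text \<open>The component of \<open>G - p\<close> containing \<open>x\<close>, for \<open>x \<noteq> p\<close>; it is \<open>{p}\<close> if \<open>x = p\<close>.\<close>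

definition branch :: "'a ugraph \<Rightarrow> 'a \<Rightarrow> 'a \<Rightarrow> 'a set" where
  "branch G p x = {(a, b). {a, b} \<in> gedges G \<and> a \<noteq> p \<and> b \<noteq> p}\<^sup>* `` {x}"

lemma branch_refl: "x \<in> branch G p x"
  by (simp add: branch_def)

lemma branch_step:
  "\<lbrakk>y \<in> branch G p x; {y, z} \<in> gedges G; y \<noteq> p; z \<noteq> p\<rbrakk> \<Longrightarrow> z \<in> branch G p x"
  unfolding branch_def by (auto intro: rtrancl_into_rtrancl)

lemma branch_induct [consumes 1, case_names base step]:
  assumes "y \<in> branch G p x" and "P x"
    and "\<And>a b. \<lbrakk>a \<in> branch G p x; {a, b} \<in> gedges G; a \<noteq> p; b \<noteq> p; P a\<rbrakk> \<Longrightarrow> P b"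
  shows "P y"
proof -
  have "(x, y) \<in> {(a, b). {a, b} \<in> gedges G \<and> a \<noteq> p \<and> b \<noteq> p}\<^sup>*"
    using assms(1) by (simp add: branch_def)
  then show ?thesis
    by (induction) (use assms(2,3) in \<open>auto simp: branch_def\<close>)
qed

lemma branch_avoids: "x \<noteq> p \<Longrightarrow> p \<notin> branch G p x"
  using branch_induct[of p G p x "\<lambda>y. y \<noteq> p"] by blast

section \<open>Structure of the branches at a vertex\<close>

locale tree =
  fixes T :: "'a ugraph"
  assumes tree: "tree_graph T"
begin

abbreviation V where "V \<equiv> gverts T"
abbreviation E where "E \<equiv> gedges T"
abbreviation br where "br \<equiv> branch T"

lemma simple: "simple_graph T" using tree by (simp add: tree_graph_def)
lemma connected: "connected_graph T" using tree by (simp add: tree_graph_def)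
lemma finV: "finite V" using simple by (simp add: simple_graph_def)
lemma finE: "finite E" using simple_graph_finite_edges[OF simple] .
lemmas adj_neq = simple_graph_adj_neq[OF simple]
lemmas adj_verts = simple_graph_adj_verts[OF simple]

lemma adj_sym: "{u, v} \<in> E \<Longrightarrow> {v, u} \<in> E"
  by (simp add: insert_commute)

lemma connected_induct [consumes 2, case_names base step]:
  assumes "x \<in> V" "y \<in> V" "P x" "\<And>a b. \<lbrakk>{a, b} \<in> E; P a\<rbrakk> \<Longrightarrow> P b"
  shows "P y"
proof -
  have "(x, y) \<in> (adj_rel T)\<^sup>*" using connected assms(1,2) by (simp add: connected_graph_def)
  then show ?thesis
    by (induction) (use assms(3,4) in \<open>auto simp: adj_rel_def\<close>)
qed

text \<open>Acyclicity enters here: a vertex common to both branches gives a path from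
  \<open>x\<close> to \<open>x'\<close> avoiding \<open>p\<close>, and it closes up through
  \<open>p\<close> to a cycle.\<close>

lemma branch_disjoint:
  assumes "{p, x} \<in> E" "{p, x'} \<in> E" "x \<noteq> x'"
  shows "br p x \<inter> br p x' = {}"
proof (rule ccontr)
  let ?r = "{(a, b). {a, b} \<in> E \<and> a \<noteq> p \<and> b \<noteq> p}"
  have "sym ?r" by (auto simp: sym_def insert_commute)
  then have "sym (?r\<^sup>*)" by (rule sym_rtrancl)
  moreover assume "br p x \<inter> br p x' \<noteq> {}"
  then obtain y where "(x, y) \<in> ?r\<^sup>*" "(x', y) \<in> ?r\<^sup>*" unfolding branch_def by blast
  ultimately have "(x, x') \<in> ?r\<^sup>*" by (meson rtrancl_trans symD)
  then obtain xs where xs: "xs \<noteq> []" "hd xs = x" "last xs = x'" "distinct xs"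
    "successively (\<lambda>a b. (a, b) \<in> ?r) xs" by (rule rtrancl_distinct_path)
  obtain ys where ys: "xs = x # ys" using xs(1,2) by (cases xs) auto
  have "ys \<noteq> []" using ys xs(3) assms(3) by auto
  have nth: "\<And>i. Suc i < length xs \<Longrightarrow> (xs ! i, xs ! Suc i) \<in> ?r"
    using xs(5) by (simp add: successively_conv_nth)
  have "p \<notin> set xs"
  proof
    assume "p \<in> set xs"
    then obtain i where i: "i < length xs" "xs ! i = p" by (meson in_set_conv_nth)
    show False
    proof (cases i)
      case 0
      then show False using i ys adj_neq[OF assms(1)] by simp
    next
      case (Suc j)
      then show False using i nth[of j] by simp
    qed
  qed
  then have "graph_cycle T (p # xs)"
    using xs nth ys \<open>ys \<noteq> []\<close> assms(1) adj_sym[OF assms(2)]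
    unfolding graph_cycle_def
    by (auto simp: nth_Cons Suc_le_eq split: nat.split)
  then show False using tree by (auto simp: tree_graph_def)
qed

text \<open>A second neighbour of \<open>p\<close> in the branch would start a branch of its own
  that is not disjoint from this one. So \<open>px\<close> is the only edge leaving
  \<open>br p x\<close>.\<close>

lemma branch_exit:
  assumes "{p, x} \<in> E" "y \<in> br p x" "{p, y} \<in> E"
  shows "y = x"
  using branch_disjoint[OF assms(1,3)] assms(2) branch_refl[of y T p] by blast

lemma no_triangle: "{u, x} \<in> E \<Longrightarrow> {u, y} \<in> E \<Longrightarrow> {x, y} \<notin> E"
  using branch_exit[of u x y] branch_step[of x T u x y] branch_refl[of x T u] adj_neq by metis

lemma branch_edge_between:
  assumes "{p, x} \<in> E" "{p, x'} \<in> E" "x \<noteq> x'" "a \<in> br p x" "b \<in> br p x'"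
  shows "{a, b} \<notin> E"
proof
  assume "{a, b} \<in> E"
  moreover have "a \<noteq> p" "b \<noteq> p"
    using branch_avoids[of x p T] branch_avoids[of x' p T] adj_neq assms by blast+
  ultimately have "b \<in> br p x" using branch_step[OF assms(4)] by blast
  then show False using branch_disjoint[OF assms(1-3)] assms(5) by blast
qed

lemma branch_subset_verts: "x \<in> V \<Longrightarrow> br p x \<subseteq> V"
proof
  fix y assume "y \<in> br p x" "x \<in> V"
  then show "y \<in> V" by (induction rule: branch_induct) (use adj_verts in blast)+
qed

text \<open>Follow a walk from \<open>p\<close>: it changes the branch only by passing through
  \<open>p\<close>.\<close>

lemma branch_cover:
  assumes "p \<in> V" "y \<in> V" "y \<noteq> p"
  obtains x where "{p, x} \<in> E" "y \<in> br p x"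
proof -
  have "y = p \<or> (\<exists>x. {p, x} \<in> E \<and> y \<in> br p x)"
    using assms(1,2)
  proof (induction rule: connected_induct)
    case base
    then show ?case by simp
  next
    case (step a b)
    then show ?case using branch_step[of a T p _ b] branch_refl by (metis)
  qed
  then show ?thesis using assms that by blast
qed

text \<open>Deleting the edge \<open>px\<close> leaves two components, one on each side. This allows
  an edge to be oriented by asking on which side a root lies.\<close>

lemma branch_opposite:
  assumes "{p, x} \<in> E"
  shows "br x p = V - br p x"
proof (intro equalityI subsetI)
  fix y assume y: "y \<in> br x p"
  then have "y = p \<or> (\<exists>x'. x' \<noteq> x \<and> {p, x'} \<in> E \<and> y \<in> br p x')"
  proof (induction rule: branch_induct)
    case base
    then show ?case by simp
  next
    case (step a b)
    then show ?case using branch_step[of a T p _ b] branch_refl by (metis)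
  qed
  then have "y \<notin> br p x"
    using branch_disjoint[OF assms] branch_avoids[of x p T] adj_neq[OF assms] by blast
  moreover have "y \<in> V" using y branch_subset_verts adj_verts[OF assms] by blast
  ultimately show "y \<in> V - br p x" by blast
next
  fix y assume y: "y \<in> V - br p x"
  have "x \<in> V" using adj_verts[OF assms] by blast
  moreover have "y \<in> V" using y by blast
  ultimately have "y \<in> br p x \<or> y \<in> br x p"
  proof (induction rule: connected_induct)
    case base
    then show ?case by (simp add: branch_refl)
  next
    case (step a b)
    have "x \<noteq> p" using adj_neq[OF assms] by simp
    then have "a \<noteq> p \<or> a \<in> br x p" "a \<noteq> x \<or> a \<in> br p x" by (auto simp: branch_refl)
    show ?case
    proof (cases "b = p \<or> b = x")
      case True
      then show ?thesis by (auto simp: branch_refl)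
    next
      case False
      from step(2) show ?thesis
      proof
        assume a: "a \<in> br p x"
        then have "a \<noteq> p" using branch_avoids \<open>x \<noteq> p\<close> by metis
        then show ?thesis using branch_step[OF a step(1)] False by blast
      next
        assume a: "a \<in> br x p"
        then have "a \<noteq> x" using branch_avoids \<open>x \<noteq> p\<close> by metis
        then show ?thesis using branch_step[OF a step(1)] False by blast
      qed
    qed
  qed
  then show "y \<in> br x p" using y by blast
qed

lemma branch_nested:
  assumes "{p, x} \<in> E" "{x, y} \<in> E" "y \<noteq> p"
  shows "br x y \<subseteq> br p x"
proof -
  have "br x y \<inter> br x p = {}"
    using branch_disjoint[OF assms(2) adj_sym[OF assms(1)] assms(3)] .
  moreover have "br x y \<subseteq> V" using branch_subset_verts adj_verts[OF assms(2)] by blast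
  moreover have "br x p = V - br p x" using branch_opposite[OF assms(1)] .
  ultimately show ?thesis by blast
qed

text \<open>Gives a branch the same shape as \<open>verts_decomp\<close> gives the whole tree, so
  that \<open>unfreeable_two\<close> can be applied to both.\<close>

lemma branch_decomp:
  assumes "{p, x} \<in> E"
  shows "br p x = {x} \<union> (\<Union>y\<in>{y. {x, y} \<in> E} - {p}. br x y)"
proof (intro equalityI subsetI)
  fix z assume z: "z \<in> br p x"
  show "z \<in> {x} \<union> (\<Union>y\<in>{y. {x, y} \<in> E} - {p}. br x y)"
  proof (cases "z = x")
    case False
    have "x \<in> V" "z \<in> V" using adj_verts[OF assms] branch_subset_verts z by blast+
    then obtain y where y: "{x, y} \<in> E" "z \<in> br x y" using branch_cover False by metis
    have "y \<noteq> p" using branch_opposite[OF assms] z y by blast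
    then show ?thesis using y by blast
  qed simp
next
  fix z assume "z \<in> {x} \<union> (\<Union>y\<in>{y. {x, y} \<in> E} - {p}. br x y)"
  then show "z \<in> br p x" using branch_nested[OF assms] branch_refl[of x T p] by blast
qed

lemma verts_decomp:
  assumes "v \<in> V"
  shows "V = {v} \<union> (\<Union>y\<in>{y. {v, y} \<in> E}. br v y)"
proof (intro equalityI subsetI)
  fix z assume "z \<in> V"
  then show "z \<in> {v} \<union> (\<Union>y\<in>{y. {v, y} \<in> E}. br v y)"
    using branch_cover[OF assms, of z] by blast
next
  fix z assume "z \<in> {v} \<union> (\<Union>y\<in>{y. {v, y} \<in> E}. br v y)"
  then show "z \<in> V" using branch_subset_verts adj_verts assms by blast
qed

text \<open>Every edge is assigned its endvertex farther from the root \<open>r\<close>.\<close>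

lemma card_edges: "card E = card V - 1"
proof -
  obtain r where r: "r \<in> V" using connected by (auto simp: connected_graph_def)
  have ex: "\<exists>x. {v, x} \<in> E \<and> r \<in> br v x" if "v \<in> V - {r}" for v
    using branch_cover[of v r] that r by blast
  then obtain par where par: "{v, par v} \<in> E" "r \<in> br v (par v)" if "v \<in> V - {r}" for v
    by (metis (no_types, lifting))
  have "bij_betw (\<lambda>v. {v, par v}) (V - {r}) E"
    unfolding bij_betw_def
  proof
    show "inj_on (\<lambda>v. {v, par v}) (V - {r})"
    proof (rule inj_onI)
      fix v w assume vw: "v \<in> V - {r}" "w \<in> V - {r}" "{v, par v} = {w, par w}"
      show "v = w"
      proof (rule ccontr)
        assume "v \<noteq> w"
        \<comment> \<open>If \<open>v\<close> and \<open>w\<close> were parents of each other,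
          \<open>r\<close> would lie on both sides of the edge \<open>vw\<close>.\<close>
        with vw have "w = par v" "v = par w" by (auto simp: doubleton_eq_iff)
        then have "r \<in> br v w" "r \<in> br w v" "{v, w} \<in> E"
          using par[OF vw(1)] par[OF vw(2)] by simp_all
        then show False using branch_opposite[of v w] by simp
      qed
    qed
    show "(\<lambda>v. {v, par v}) ` (V - {r}) = E"
    proof (intro equalityI subsetI)
      fix e assume e: "e \<in> E"
      then obtain a b where ab: "e = {a, b}" using simple_graph_edgeE[OF simple] by metis
      have key: "{a, b} \<in> (\<lambda>v. {v, par v}) ` (V - {r})" if "{a, b} \<in> E" "r \<in> br a b" for a b
      proof -
        have "r \<noteq> a" using branch_avoids[of b a T] adj_neq[OF that(1)] that(2) by metis
        then have a: "a \<in> V - {r}" using adj_verts[OF that(1)] by simp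
        have "par a = b"
        proof (rule ccontr)
          assume "par a \<noteq> b"
          then show False using branch_disjoint[OF that(1) par(1)[OF a]] par(2)[OF a] that(2) by auto
        qed
        then show ?thesis using a by (intro image_eqI[of _ _ a]) simp_all
      qed
      have "r \<in> br a b \<or> r \<in> br b a" using branch_opposite[of a b] e ab r by blast
      then show "e \<in> (\<lambda>v. {v, par v}) ` (V - {r})"
        using key[of a b] key[of b a] e ab by (auto simp: insert_commute)
    qed (use par(1) in auto)
  qed
  then have "card E = card (V - {r})" using bij_betw_same_card by metis
  then show ?thesis using r by simp
qed

end

section \<open>Trees without an edge open packing larger than a given induced matching\<close>

text \<open>The function \<open>own\<close> assigns the edges of \<open>M\<close>, the legs, to the centers. The last conjunct
  says that \<open>a'\<close> is a leaf of \<open>G\<close>.\<close>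

definition leaf_leg :: "'a ugraph \<Rightarrow> 'a set set \<Rightarrow> ('a set \<Rightarrow> 'a) \<Rightarrow> 'a \<Rightarrow> 'a \<Rightarrow> 'a \<Rightarrow> bool" where
  "leaf_leg G M own v a a' \<longleftrightarrow> {a, a'} \<in> M \<and> own {a, a'} = v \<and> {v, a} \<in> gedges G \<and>
     (\<forall>u. {a', u} \<in> gedges G \<longrightarrow> u = a)"

section \<open>Freeing a neighbour and gaining an edge\<close>

locale induced_matching_tree = tree +
  fixes M :: "'a set set"
  assumes M: "induced_matching T M"
begin

definition restr :: "'a set \<Rightarrow> 'a set set" where
  "restr S = {m \<in> M. m \<subseteq> S}"

definition freeable :: "'a \<Rightarrow> 'a \<Rightarrow> bool" where
  "freeable p x \<longleftrightarrow>
     (\<exists>B. eop_set T B \<and> \<Union>B \<subseteq> br p x - {x} \<and> card (restr (br p x)) \<le> card B)"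

definition gainful :: "'a set \<Rightarrow> bool" where
  "gainful S \<longleftrightarrow> (\<exists>B. eop_set T B \<and> \<Union>B \<subseteq> S \<and> card (restr S) < card B)"

lemma M_edges: "m \<in> M \<Longrightarrow> m \<in> E"
  using M by (auto simp: induced_matching_iff)

lemma finM: "finite M"
  by (rule finite_subset[OF _ finE]) (simp add: subsetI M_edges)

lemma restr_induced: "induced_matching T (restr S)"
  by (rule induced_matching_subset[OF M]) (simp add: restr_def subsetI)

lemma restr_eop: "eop_set T (restr S)"
  using induced_matching_imp_eop_set[OF restr_induced] .

lemma fin_restr: "finite (restr S)"
  by (simp add: restr_def finM)

lemma Union_restr: "\<Union>(restr S) \<subseteq> S \<inter> \<Union>M"
  by (auto simp: restr_def)

lemma partnerE:
  assumes "x \<in> \<Union>M"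
  obtains x' where "{x, x'} \<in> M" "x' \<noteq> x"
proof -
  from assms obtain m where m: "m \<in> M" "x \<in> m" by (rule UnionE)
  obtain x' where "m = {x, x'}" "x \<noteq> x'"
    using simple_graph_edge_other[OF simple M_edges[OF m(1)] m(2)] .
  then show ?thesis using that m by metis
qed

lemma covered_adj:
  assumes "x \<in> \<Union>M" "y \<in> \<Union>M" "{x, y} \<in> E"
  shows "{x, y} \<in> M"
proof -
  from assms(1) obtain m where m: "m \<in> M" "x \<in> m" by (rule UnionE)
  from assms(2) obtain m' where m': "m' \<in> M" "y \<in> m'" by (rule UnionE)
  have "m' = m" using induced_matching_adj[OF M m(1) m'(1) m(2) m'(2) assms(3)] .
  then have "m = {x, y}"
    using simple_graph_edge_eq[OF simple M_edges[OF m(1)] m(2)] m'(2) adj_neq[OF assms(3)] by simp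
  then show ?thesis using m(1) by simp
qed

lemma partner_unique:
  assumes "{x, x'} \<in> M" "{x, y} \<in> M"
  shows "y = x'"
  using induced_matching_unique[OF M assms, of x] by (auto simp: doubleton_eq_iff)

lemma edge_in_branch:
  assumes "m \<in> E" "p \<notin> m" "a \<in> m" "a \<in> br p x"
  shows "m \<subseteq> br p x"
proof
  fix b assume b: "b \<in> m"
  show "b \<in> br p x"
  proof (cases "b = a")
    case False
    then have "m = {a, b}" using simple_graph_edge_eq[OF simple assms(1,3) b] by simp
    then show ?thesis using branch_step[OF assms(4), of b] assms(1,2) by auto
  qed (use assms in simp)
qed

lemma freeable_uncovered:
  assumes "x \<notin> \<Union>M"
  shows "freeable p x"
  unfolding freeable_def
  by (rule exI[of _ "restr (br p x)"]) (use Union_restr[of "br p x"] assms restr_eop in auto)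

text \<open>A further neighbour \<open>u\<close> of \<open>x'\<close> is uncovered, and it is not
  adjacent to \<open>x\<close>. The star exchange at \<open>u\<close> replaces \<open>xx'\<close> by
  \<open>ux'\<close>; after that no chosen edge contains \<open>x\<close>, and none has been lost in
  number.\<close>

lemma freeable_partner_nonleaf:
  assumes px: "{p, x} \<in> E" and xx': "{x, x'} \<in> M" and p: "x' \<noteq> p"
    and u: "{x', u} \<in> E" "u \<noteq> x"
  shows "freeable p x"
proof -
  let ?R = "restr (br p x)"
  \<comment> \<open>Only covered neighbours enter the star, so the exchange has nothing to check for
    uncovered members of \<open>Z\<close>.\<close>
  let ?Z = "{z \<in> \<Union>?R. {u, z} \<in> E}"
  let ?B = "{m \<in> ?R. \<forall>z\<in>m. {u, z} \<notin> E} \<union> (\<lambda>z. {u, z}) ` ?Z"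
  have xx'E: "{x, x'} \<in> E" using M_edges[OF xx'] .
  have x'b: "x' \<in> br p x"
    using branch_step[OF branch_refl xx'E] adj_neq[OF px] p by simp
  have up: "u \<noteq> p"
  proof
    assume "u = p"
    then have "{p, x'} \<in> E" using adj_sym[OF u(1)] by simp
    then show False using no_triangle[OF px, of x'] xx'E by simp
  qed
  have ub: "u \<in> br p x" using branch_step[OF x'b u(1) p up] .
  have uM: "u \<notin> \<Union>M"
  proof
    assume "u \<in> \<Union>M"
    moreover have "x' \<in> \<Union>M" using xx' by (rule UnionI) simp
    ultimately have "{x', u} \<in> M" using covered_adj u(1) by simp
    then show False using partner_unique[of x' x u] xx' u(2) by (simp add: insert_commute)
  qed
  have uR: "u \<notin> \<Union>?R" using uM Union_restr[of "br p x"] by auto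
  have xR: "{x, x'} \<in> ?R" using xx' x'b branch_refl[of x T p] by (simp add: restr_def)
  have B: "eop_set T ?B" "card ?R + card (?Z - \<Union>?R) \<le> card ?B"
    by (rule eop_set_star_exchange[OF simple restr_induced uR]; auto dest: no_triangle)+
  have nux: "{u, x} \<notin> E" using no_triangle[of x' u x] u(1) adj_sym[OF xx'E] adj_sym by blast
  have "\<Union>?B \<subseteq> br p x" using ub Union_restr[of "br p x"] by auto
  moreover have "x \<notin> \<Union>?B"
  proof
    assume "x \<in> \<Union>?B"
    then obtain e where e: "e \<in> ?B" "x \<in> e" by (rule UnionE)
    from e(1) consider m where "m \<in> ?R" "\<forall>z\<in>m. {u, z} \<notin> E" "x \<in> m"
      | z where "{u, z} \<in> E" "x \<in> {u, z}"
    proof (rule UnE)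
      assume "e \<in> {m \<in> ?R. \<forall>z\<in>m. {u, z} \<notin> E}"
      then show ?thesis using that(1)[of e] e(2) by simp
    next
      assume "e \<in> (\<lambda>z. {u, z}) ` ?Z"
      then obtain z where "z \<in> ?Z" "e = {u, z}" by (rule imageE)
      then show ?thesis using that(2)[of z] e(2) by simp
    qed
    then show False
    proof cases
      case 1
      have "m = {x, x'}"
        using induced_matching_unique[OF restr_induced xR 1(1) _ 1(3)] by simp
      then show False using 1(2) adj_sym[OF u(1)] by simp
    next
      case 2
      then show False using nux u(2) by auto
    qed
  qed
  ultimately have "\<Union>?B \<subseteq> br p x - {x}" by (simp only: subset_Diff_insert Diff_empty simp_thms)
  moreover have "card ?R \<le> card ?B" using B(2) by linarith
  ultimately show ?thesis unfolding freeable_def using B(1) by (intro exI conjI)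
qed

text \<open>The surplus edge gained in \<open>br x w\<close> pays for giving up \<open>xx'\<close>,
  the only edge of \<open>M\<close> at \<open>x\<close>.\<close>

lemma freeable_gainful:
  assumes px: "{p, x} \<in> E" and xx': "{x, x'} \<in> M" and p: "x' \<noteq> p"
    and w: "{x, w} \<in> E" "w \<noteq> p" "w \<notin> \<Union>M" and g: "gainful (br x w)"
  shows "freeable p x"
proof -
  obtain B where B: "eop_set T B" "\<Union>B \<subseteq> br x w" "card (restr (br x w)) < card B"
    using g unfolding gainful_def by blast
  let ?R = "restr (br p x)" let ?W = "restr (br x w)"
  let ?D = "?R - ?W - {{x, x'}}"
  have xx'E: "{x, x'} \<in> E" using M_edges[OF xx'] .
  have x'b: "x' \<in> br p x"
    using branch_step[OF branch_refl xx'E] adj_neq[OF px] p by simp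
  have nest: "br x w \<subseteq> br p x" using branch_nested[OF px w(1,2)] .
  have xw: "x \<notin> br x w" using branch_avoids[of w x T] adj_neq[OF w(1)] by simp
  have D: "m \<in> M" "x \<notin> m" "m \<inter> br x w = {}" "m \<subseteq> br p x" if "m \<in> ?D" for m
  proof -
    show mM: "m \<in> M" and "m \<subseteq> br p x" using that by (simp_all add: restr_def)
    show xm: "x \<notin> m"
    proof
      assume "x \<in> m"
      then have "m = {x, x'}" using induced_matching_unique[OF M xx' mM, of x] by simp
      then show False using that by simp
    qed
    show "m \<inter> br x w = {}"
    proof (rule ccontr)
      assume "m \<inter> br x w \<noteq> {}"
      then obtain a where "a \<in> m" "a \<in> br x w" by blast
      then have "m \<subseteq> br x w" using edge_in_branch[OF M_edges[OF mM] xm] by simp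
      then show False using that mM by (simp add: restr_def)
    qed
  qed
  have "?D \<subseteq> M" using D(1) by blast
  then have eD: "eop_set T ?D"
    using induced_matching_imp_eop_set[OF induced_matching_subset[OF M]] by simp
  \<comment> \<open>Every edge leaving \<open>br x w\<close> ends in \<open>x\<close>, and no edge
    of \<open>?D\<close> contains \<open>x\<close>.\<close>
  have sep: "{a, b} \<notin> E" if ab: "a \<in> \<Union>B" "b \<in> \<Union>?D" for a b
  proof
    assume e: "{a, b} \<in> E"
    from ab(2) obtain m where m: "m \<in> ?D" "b \<in> m" by (rule UnionE)
    have a: "a \<in> br x w" using ab(1) B(2) by (rule subsetD[rotated])
    have "b \<noteq> x" "a \<noteq> x" using D(2)[OF m(1)] m(2) a xw by auto
    then have "b \<in> br x w" using branch_step[OF a e] by simp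
    then show False using D(3)[OF m(1)] m(2) by auto
  qed
  have cB: "card (B \<union> ?D) = card B + card ?D" by (rule card_eop_set_Un[OF simple B(1) eD sep])
  have "?W \<subseteq> ?R" using nest by (auto simp: restr_def)
  then have "card (?R - ?W) = card ?R - card ?W" "card ?W \<le> card ?R"
    using fin_restr by (simp_all add: card_Diff_subset card_mono)
  moreover have "card (?R - ?W) \<le> Suc (card ?D)"
  proof -
    have "card (?R - ?W) - card {{x, x'}} \<le> card ?D" by (rule diff_card_le_card_Diff) simp
    then show ?thesis by simp
  qed
  ultimately have "card ?R \<le> card (B \<union> ?D)" using cB B(3) by linarith
  moreover have "\<Union>(B \<union> ?D) \<subseteq> br p x - {x}"
  proof -
    have "\<Union>B \<subseteq> br p x - {x}" using B(2) nest xw by auto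
    moreover have "\<Union>?D \<subseteq> br p x - {x}" using D(2,4) by (simp add: Sup_le_iff subset_Diff_insert)
    ultimately show ?thesis by simp
  qed
  ultimately show ?thesis
    unfolding freeable_def using eop_set_Un[OF B(1) eD sep] by blast
qed

text \<open>In the branch at \<open>y\<close> keep \<open>M\<close> and add the edge
  \<open>vy\<close>; in every other branch take a packing that avoids the neighbour of
  \<open>v\<close>. Nothing is lost in any branch, and one edge is gained at
  \<open>y\<close>.\<close>

lemma star_gain:
  assumes v: "v \<notin> \<Union>M" and X: "X \<subseteq> {x. {v, x} \<in> E}"
    and y: "y \<in> X" "y \<in> \<Union>M" and fr: "\<And>x. x \<in> X \<Longrightarrow> x \<noteq> y \<Longrightarrow> freeable v x"
  shows "gainful ({v} \<union> (\<Union>x\<in>X. br v x))"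
proof -
  let ?S = "{v} \<union> (\<Union>x\<in>X. br v x)"
  have XE: "{v, x} \<in> E" if "x \<in> X" for x using X that by (simp add: subset_iff)
  have "X \<subseteq> V" using XE adj_verts by blast
  then have fX: "finite X" using finV finite_subset by blast
  have "\<exists>B. eop_set T B \<and> \<Union>B \<subseteq> br v x - {x} \<and> card (restr (br v x)) \<le> card B"
    if "x \<in> X - {y}" for x using fr[of x] that by (simp add: freeable_def)
  then obtain F where F: "eop_set T (F x)" "\<Union>(F x) \<subseteq> br v x - {x}"
    "card (restr (br v x)) \<le> card (F x)" if "x \<in> X - {y}" for x by metis
  let ?Y = "restr (br v y)"
  define B where "B x = (if x = y then insert {v, y} ?Y else F x)" for x
  have vY: "v \<notin> \<Union>?Y" using v Union_restr[of "br v y"] by auto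
  have eY: "eop_set T (insert {v, y} ?Y)"
  proof -
    have key: "{a, b} = {v, y} \<or> {a, b} = m"
      if m: "m \<in> ?Y" "b \<in> m" and a: "a \<in> {v, y}" and ab: "{a, b} \<in> E" for a b m
    proof -
      have bM: "m \<in> M" "b \<in> br v y" using m by (auto simp: restr_def)
      consider "a = v" | "a = y" using a by blast
      then show ?thesis
      proof cases
        case 1
        then have "b = y" using branch_exit[OF XE[OF y(1)] bM(2)] ab by simp
        then show ?thesis using 1 by simp
      next
        case 2
        have "b \<in> \<Union>M" using bM(1) m(2) by (rule UnionI)
        then have "{y, b} \<in> M" using covered_adj[OF y(2)] ab 2 by simp
        then have "m = {y, b}" using induced_matching_unique[OF M _ bM(1) _ m(2)] by simp
        then show ?thesis using 2 by simp
      qed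
    qed
    show ?thesis
    proof (rule eop_setI)
      show "insert {v, y} ?Y \<subseteq> E" using XE[OF y(1)] restr_eop[of "br v y"] by (simp add: eop_set_def)
    next
      fix e\<^sub>1 e\<^sub>2 a b
      assume *: "e\<^sub>1 \<in> insert {v, y} ?Y" "e\<^sub>2 \<in> insert {v, y} ?Y" "e\<^sub>1 \<noteq> e\<^sub>2" "a \<in> e\<^sub>1" "b \<in> e\<^sub>2"
        "{a, b} \<in> E"
      then consider "e\<^sub>1 \<in> ?Y" "e\<^sub>2 \<in> ?Y" | "e\<^sub>1 = {v, y}" "e\<^sub>2 \<in> ?Y" | "e\<^sub>1 \<in> ?Y" "e\<^sub>2 = {v, y}"
        by (metis insertE)
      then show "{a, b} = e\<^sub>1 \<or> {a, b} = e\<^sub>2"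
      proof cases
        case 1
        then show ?thesis using eop_setD[OF restr_eop 1 *(3-6)] by simp
      next
        case 2
        then show ?thesis using key[OF 2(2) *(5), of a] *(4,6) by simp
      next
        case 3
        have "{b, a} = {v, y} \<or> {b, a} = e\<^sub>1" using key[OF 3(1) *(4), of b] *(5) 3(2) adj_sym[OF *(6)] by simp
        then show ?thesis using 3(2) by (simp add: doubleton_eq_iff) blast
      qed
    qed
  qed
  have cY: "card (insert {v, y} ?Y) = Suc (card ?Y)"
  proof -
    have "{v, y} \<notin> ?Y" using vY by auto
    then show ?thesis using fin_restr by simp
  qed
  have eB: "eop_set T (B x)" if "x \<in> X" for x using that eY F(1) by (simp add: B_def)
  \<comment> \<open>Only the part at \<open>y\<close> uses \<open>v\<close> or its own neighbour of
    \<open>v\<close>; this is what keeps the parts separated.\<close>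
  have sub: "a \<in> br v x \<or> x = y \<and> a = v" "a = x \<Longrightarrow> x = y" if "x \<in> X" "a \<in> \<Union>(B x)" for x a
  proof -
    have "\<Union>(B x) \<subseteq> insert v (br v x)" "\<Union>(B x) \<subseteq> br v x - {x}" if "x \<noteq> y"
      using F(2)[of x] that \<open>x \<in> X\<close> by (auto simp: B_def)
    moreover have "\<Union>(B x) \<subseteq> insert v (br v x)" if "x = y"
      using that Union_restr[of "br v y"] branch_refl[of y T v] by (auto simp: B_def)
    ultimately show "a \<in> br v x \<or> x = y \<and> a = v" "a = x \<Longrightarrow> x = y" using that(2) by blast+
  qed
  have sep: "{a, b} \<notin> E"
    if "x \<in> X" "z \<in> X" "x \<noteq> z" "a \<in> \<Union>(B x)" "b \<in> \<Union>(B z)" for x z a b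
  proof
    note x = that(1,4) and z = that(2,5)
    assume ab: "{a, b} \<in> E"
    consider "a \<in> br v x" "b \<in> br v z" | "a = v" "x = y" "b \<in> br v z" | "a \<in> br v x" "b = v" "z = y"
      using sub(1)[OF x] sub(1)[OF z] \<open>x \<noteq> z\<close> by blast
    then show False
    proof cases
      case 1
      then show False using branch_edge_between[OF XE[OF x(1)] XE[OF z(1)] \<open>x \<noteq> z\<close>] ab by simp
    next
      case 2
      then have "b = z" using branch_exit[OF XE[OF z(1)]] ab by simp
      then show False using sub(2)[OF z] 2 \<open>x \<noteq> z\<close> by simp
    next
      case 3
      then have "a = x" using branch_exit[OF XE[OF x(1)]] adj_sym[OF ab] by simp
      then show False using sub(2)[OF x] 3 \<open>x \<noteq> z\<close> by simp
    qed
  qed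
  have UB: "eop_set T (\<Union>x\<in>X. B x) \<and> card (\<Union>x\<in>X. B x) = (\<Sum>x\<in>X. card (B x))"
    by (rule eop_set_UN[OF simple fX eB sep])
  have "(\<Sum>x\<in>X. card (restr (br v x))) < (\<Sum>x\<in>X. card (B x))"
  proof (rule sum_strict_mono_ex1[OF fX])
    show "\<forall>x\<in>X. card (restr (br v x)) \<le> card (B x)" using F(3) cY by (simp add: B_def)
    show "\<exists>x\<in>X. card (restr (br v x)) < card (B x)" using y(1) cY by (auto simp: B_def)
  qed
  moreover have "card (restr ?S) \<le> (\<Sum>x\<in>X. card (restr (br v x)))"
  proof -
    \<comment> \<open>As \<open>v\<close> is uncovered, an edge of \<open>M\<close> inside
      \<open>?S\<close> cannot pass through \<open>v\<close> and hence stays within one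
      branch.\<close>
    have "restr ?S \<subseteq> (\<Union>x\<in>X. restr (br v x))"
    proof
      fix m assume "m \<in> restr ?S"
      then have m: "m \<in> M" "m \<subseteq> ?S" by (simp_all add: restr_def)
      obtain a b where ab: "m = {a, b}" using simple_graph_edgeE[OF simple M_edges[OF m(1)]] by metis
      have vm: "v \<notin> m" using v m(1) by (meson UnionI)
      then obtain x where x: "x \<in> X" "a \<in> br v x" using m(2) ab by auto
      have "m \<subseteq> br v x" using edge_in_branch[OF M_edges[OF m(1)] vm _ x(2)] ab by simp
      then show "m \<in> (\<Union>x\<in>X. restr (br v x))" using x(1) m(1) by (auto simp: restr_def)
    qed
    then have "card (restr ?S) \<le> card (\<Union>x\<in>X. restr (br v x))"
      using fX fin_restr by (simp add: card_mono)
    also have "\<dots> \<le> (\<Sum>x\<in>X. card (restr (br v x)))" by (rule card_UN_le[OF fX])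
    finally show ?thesis .
  qed
  ultimately have "card (restr ?S) < card (\<Union>x\<in>X. B x)" using UB by simp
  moreover have "\<Union>(\<Union>x\<in>X. B x) \<subseteq> ?S"
  proof
    fix a assume "a \<in> \<Union>(\<Union>x\<in>X. B x)"
    then obtain x where "x \<in> X" "a \<in> \<Union>(B x)" by blast
    then show "a \<in> ?S" using sub(1)[of x a] by auto
  qed
  ultimately show ?thesis unfolding gainful_def using UB by blast
qed

text \<open>The contrapositive of \<open>star_gain\<close>, applied first with \<open>y\<close> and
  then with the vertex \<open>a\<close> found. The second application is possible because a vertex
  that is not freeable must be covered.\<close>

lemma unfreeable_two:
  assumes v: "v \<notin> \<Union>M" and X: "X \<subseteq> {x. {v, x} \<in> E}" and y: "y \<in> X" "y \<in> \<Union>M"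
    and ng: "\<not> gainful ({v} \<union> (\<Union>x\<in>X. br v x))"
  obtains a b where "a \<in> X" "b \<in> X" "a \<noteq> b" "\<not> freeable v a" "\<not> freeable v b"
proof -
  obtain a where a: "a \<in> X" "\<not> freeable v a" using star_gain[OF v X y] ng by metis
  then have "a \<in> \<Union>M" using freeable_uncovered by metis
  then obtain b where "b \<in> X" "b \<noteq> a" "\<not> freeable v b" using star_gain[OF v X a(1)] ng by metis
  then show ?thesis using that a by metis
qed

lemma unfreeable_leaf_leg:
  assumes "{v, x} \<in> E" "v \<notin> \<Union>M" "\<not> freeable v x"
  obtains x' where "{x, x'} \<in> M" "x' \<noteq> v" "\<And>u. {x', u} \<in> E \<Longrightarrow> u = x"
proof -
  have "x \<in> \<Union>M" using freeable_uncovered assms(3) by metis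
  then obtain x' where x': "{x, x'} \<in> M" by (rule partnerE)
  have "x' \<noteq> v" using x' assms(2) by auto
  then show ?thesis using that[OF x'] freeable_partner_nonleaf[OF assms(1) x'] assms(3) by metis
qed

end

section \<open>Claims of the centers on leaf legs\<close>

locale eop_extremal_tree = induced_matching_tree +
  assumes extremal: "eop_set T B \<Longrightarrow> card B \<le> card M"
begin

lemma not_gainful_verts: "\<not> gainful V"
proof -
  have "m \<subseteq> V" if "m \<in> M" for m
    using M_edges[OF that] simple by (simp add: simple_graph_def)
  then have "restr V = M" by (auto simp: restr_def)
  then show ?thesis using extremal unfolding gainful_def by (simp add: not_less)
qed

text \<open>Otherwise \<open>u\<close> is uncovered too, and the star exchange at \<open>u\<close>
  may include the extra edge \<open>uv\<close>, since \<open>v\<close> has no covered neighbour.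
  This gives a packing with more edges than \<open>M\<close>.\<close>

lemma uncovered_adj_covered:
  assumes v: "v \<notin> \<Union>M" and vu: "{v, u} \<in> E"
  shows "\<exists>y\<in>\<Union>M. {v, y} \<in> E"
proof (rule ccontr)
  assume *: "\<not> ?thesis"
  let ?Z = "insert v {z \<in> \<Union>M. {u, z} \<in> E}"
  let ?B = "{m \<in> M. \<forall>z\<in>m. {u, z} \<notin> E} \<union> (\<lambda>z. {u, z}) ` ?Z"
  have u: "u \<notin> \<Union>M" using * vu by blast
  have uv: "{u, v} \<in> E" using adj_sym[OF vu] .
  have "?Z - \<Union>M = {v}" using v by blast
  moreover have "eop_set T ?B \<and> card M + card (?Z - \<Union>M) \<le> card ?B"
  proof
    have 1: "?Z \<subseteq> {z. {u, z} \<in> E}" using uv by (simp add: subset_iff)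
    have 2: "{z \<in> \<Union>M. {u, z} \<in> E} \<subseteq> ?Z" by (rule subset_insertI)
    have 3: "{z, y} \<notin> E" if "z \<in> ?Z" "z \<notin> \<Union>M" "y \<in> \<Union>M" for z y using that * by blast
    show "eop_set T ?B" by (rule eop_set_star_exchange(1)[OF simple M u no_triangle 1 2 3])
    show "card M + card (?Z - \<Union>M) \<le> card ?B"
      by (rule eop_set_star_exchange(2)[OF simple M u no_triangle 1 2 3])
  qed
  ultimately have "eop_set T ?B" "card M < card ?B" by simp_all
  then show False using extremal[of ?B] by linarith
qed

definition claims :: "'a \<Rightarrow> 'a \<Rightarrow> bool" where
  "claims v x \<longleftrightarrow> v \<in> V - \<Union>M \<and> {v, x} \<in> E \<and> \<not> freeable v x"

lemma claims_leaf_leg: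
  assumes "claims v x"
  obtains x' where "{x, x'} \<in> M" "\<And>u. {x', u} \<in> E \<Longrightarrow> u = x"
  using assms unfreeable_leaf_leg unfolding claims_def by (metis DiffD2)

text \<open>Seen from \<open>v\<close>, the whole tree is \<open>v\<close> with all its branches,
  and extremality forbids a gain there. A second vertex guarantees a neighbour of \<open>v\<close>,
  hence a covered one from which to start.\<close>

lemma two_claims:
  assumes v: "v \<in> V - \<Union>M" and V: "V \<noteq> {v}"
  obtains a b where "a \<noteq> b" "claims v a" "claims v b"
proof -
  obtain z where "z \<in> V" "z \<noteq> v" using v V by blast
  then obtain u where "{v, u} \<in> E" using branch_cover[of v z] v by blast
  then obtain y where y: "y \<in> \<Union>M" "{v, y} \<in> E" using uncovered_adj_covered[of v u] v by blast
  have "\<not> gainful ({v} \<union> (\<Union>x\<in>{x. {v, x} \<in> E}. br v x))"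
    using not_gainful_verts verts_decomp[of v] v by simp
  then show ?thesis
    using unfreeable_two[of v "{x. {v, x} \<in> E}" y] v y that unfolding claims_def by blast
qed

text \<open>Giving up \<open>x\<close> in the branch at \<open>v\<close> costs the edge \<open>xx'\<close> of \<open>M\<close>. If \<open>w\<close> had at most one claim
  besides \<open>x\<close>, a star edge at \<open>w\<close> would make up for this loss and \<open>v\<close> could not claim \<open>x\<close>.\<close>

lemma contested_claims:
  assumes w: "claims w x" and v: "claims v x" and "v \<noteq> w"
  obtains a b where "a \<noteq> b" "a \<noteq> x" "b \<noteq> x" "claims w a" "claims w b"
proof -
  have vC: "v \<in> V" "v \<notin> \<Union>M" "{v, x} \<in> E" "\<not> freeable v x" using v by (simp_all add: claims_def)
  have wC: "w \<in> V" "w \<notin> \<Union>M" "{w, x} \<in> E" using w by (simp_all add: claims_def)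
  obtain x' where x': "{x, x'} \<in> M" "x' \<noteq> v" using unfreeable_leaf_leg[OF vC(3,2,4)] by metis
  have "\<not> gainful (br x w)"
    using freeable_gainful[OF vC(3) x' adj_sym[OF wC(3)] _ wC(2)] vC(4) \<open>v \<noteq> w\<close> by blast
  \<comment> \<open>Seen from \<open>x\<close>, the branch at \<open>w\<close> is \<open>w\<close>
    with all its branches except the one towards \<open>x\<close>; the two claims found inside it
    therefore differ from \<open>x\<close>.\<close>
  then have ng: "\<not> gainful ({w} \<union> (\<Union>y\<in>{y. {w, y} \<in> E} - {x}. br w y))"
    using branch_decomp[OF adj_sym[OF wC(3)]] by simp
  have "V \<noteq> {w}" using vC(1) \<open>v \<noteq> w\<close> by blast
  then obtain a b where "a \<noteq> b" "claims w a" "claims w b" using two_claims[of w] wC(1,2) by blast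
  \<comment> \<open>\<open>unfreeable_two\<close> needs a covered neighbour of \<open>w\<close>
    other than \<open>x\<close> to start from; one of the two claims of \<open>w\<close> provides
    it.\<close>
  then obtain y where "y \<noteq> x" "claims w y" by metis
  then have y: "y \<in> {y. {w, y} \<in> E} - {x}" "y \<in> \<Union>M"
    using freeable_uncovered unfolding claims_def by blast+
  obtain a b where "a \<in> {y. {w, y} \<in> E} - {x}" "b \<in> {y. {w, y} \<in> E} - {x}" "a \<noteq> b"
    "\<not> freeable w a" "\<not> freeable w b"
    using unfreeable_two[OF wC(2) _ y ng] by blast
  then show ?thesis using that wC(1,2) unfolding claims_def by blast
qed

text \<open>A walk from \<open>m\<close> to \<open>c\<close> has to leave \<open>m\<close>, and
  since \<open>M\<close> is induced it can only step to an uncovered vertex. This provides an owner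
  for legs that no center has a decisive claim to.\<close>

lemma matching_edge_adj_uncovered:
  assumes c: "c \<in> V - \<Union>M" and m: "m \<in> M"
  obtains v x where "v \<in> V - \<Union>M" "x \<in> m" "{v, x} \<in> E"
proof -
  obtain a b where ab: "m = {a, b}" using simple_graph_edgeE[OF simple M_edges[OF m]] by metis
  have "a \<in> V" using simple_graph_adj_verts[OF simple] M_edges[OF m] ab by metis
  moreover have "c \<in> V" using c by simp
  ultimately have "c \<in> m \<or> (\<exists>v x. v \<in> V - \<Union>M \<and> x \<in> m \<and> {v, x} \<in> E)"
  proof (induction rule: connected_induct)
    case base
    then show ?case using ab by simp
  next
    case (step y z)
    show ?case
    proof (cases "y \<in> m \<and> z \<in> \<Union>M")
      case True
      then have "{y, z} \<in> M" using covered_adj[of y z] m step(1) by (meson UnionI)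
      then have "{y, z} = m" using induced_matching_unique[OF M m, of "{y, z}" y] True by simp
      then show ?thesis by blast
    next
      case False
      then show ?thesis using step adj_sym[OF step(1)] adj_verts[OF step(1)] by blast
    qed
  qed
  then show ?thesis using that c m by (meson DiffD2 UnionI)
qed

text \<open>A leg claimed by several centers goes to the claimant nearer to a root \<open>r\<close>, if there is one.
  A center loses at most the leg in the direction of \<open>r\<close>, and it can afford that by \<open>contested_claims\<close>.\<close>

lemma leaf_legs_assignment:
  assumes r: "r \<in> V - \<Union>M" and V: "V \<noteq> {r}"
  obtains own where
    "\<And>m. m \<in> M \<Longrightarrow> own m \<in> V - \<Union>M \<and> (\<exists>x\<in>m. {own m, x} \<in> E)"
    "\<And>v. v \<in> V - \<Union>M \<Longrightarrow>
       \<exists>a a' b b'. leaf_leg T M own v a a' \<and> leaf_leg T M own v b b' \<and> {a, a'} \<noteq> {b, b'}"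
proof -
  \<comment> \<open>Seen from \<open>x\<close>, the root lies behind at most one neighbour, so at
    most one claimant is preferred; without a preferred one, only a sole claimant succeeds.\<close>
  define good where "good v x \<longleftrightarrow> claims v x \<and> (r \<in> br x v \<or> (\<forall>w. claims w x \<longrightarrow> w = v))" for v x
  have good_unique: "w = v" if "good v x" "good w x" for v w x
  proof (rule ccontr)
    assume "w \<noteq> v"
    then have "claims v x" "claims w x" "r \<in> br x v" "r \<in> br x w" using that by (auto simp: good_def)
    then show False
      using branch_disjoint[of x v w] \<open>w \<noteq> v\<close> unfolding claims_def by (auto simp: insert_commute)
  qed
  \<comment> \<open>The two ends of a leg cannot both be claimed: if \<open>x\<close> is claimed,
    the other end is a leaf whose only neighbour is \<open>x\<close>, and \<open>x\<close> is
    covered and thus no center.\<close>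
  have claim_unique: "y = x" if m: "m \<in> M" "x \<in> m" "y \<in> m" and cl: "claims v x" "claims w y" for m x y v w
  proof (rule ccontr)
    assume "y \<noteq> x"
    obtain x' where x': "{x, x'} \<in> M" "\<And>u. {x', u} \<in> E \<Longrightarrow> u = x" using claims_leaf_leg[OF cl(1)] by blast
    have "m = {x, x'}" using induced_matching_unique[OF M x'(1) m(1), of x] m(2) by simp
    then have "y = x'" using m(3) \<open>y \<noteq> x\<close> by simp
    then have "w = x" using x'(2) cl(2) unfolding claims_def by (simp add: insert_commute)
    then show False using cl(2) m(1,2) unfolding claims_def by blast
  qed
  have "\<exists>v. v \<in> V - \<Union>M \<and> (\<exists>x\<in>m. {v, x} \<in> E) \<and> (\<forall>x\<in>m. \<forall>w. good w x \<longrightarrow> w = v)"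
    if m: "m \<in> M" for m
  proof (cases "\<exists>x\<in>m. \<exists>v. good v x")
    case True
    then obtain x v where x: "x \<in> m" "good v x" by blast
    have "w = v" if "y \<in> m" "good w y" for y w
      using claim_unique[OF m x(1) that(1)] x(2) that(2) good_unique unfolding good_def by metis
    then show ?thesis using x unfolding good_def claims_def by blast
  next
    case False
    \<comment> \<open>With no good claim on the leg, any adjacent center may own it.\<close>
    then show ?thesis using matching_edge_adj_uncovered[OF r m] by metis
  qed
  then have "\<exists>own. \<forall>m\<in>M. own m \<in> V - \<Union>M \<and> (\<exists>x\<in>m. {own m, x} \<in> E) \<and>
      (\<forall>x\<in>m. \<forall>w. good w x \<longrightarrow> w = own m)"
    by (intro bchoice) blast
  then obtain own where own': "\<forall>m\<in>M. own m \<in> V - \<Union>M \<and> (\<exists>x\<in>m. {own m, x} \<in> E) \<and>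
      (\<forall>x\<in>m. \<forall>w. good w x \<longrightarrow> w = own m)" by (rule exE)
  have own: "own m \<in> V - \<Union>M \<and> (\<exists>x\<in>m. {own m, x} \<in> E)"
    "\<And>x w. x \<in> m \<Longrightarrow> good w x \<Longrightarrow> w = own m" if "m \<in> M" for m
    using bspec[OF own' that] by simp_all
  have two: "\<exists>a b. a \<noteq> b \<and> good v a \<and> good v b" if v: "v \<in> V - \<Union>M" for v
  proof (cases "\<exists>x. claims v x \<and> \<not> good v x")
    case True
    then obtain x w where x: "claims v x" "r \<notin> br x v" "claims w x" "w \<noteq> v"
      unfolding good_def by blast
    obtain a b where ab: "a \<noteq> b" "a \<noteq> x" "b \<noteq> x" "claims v a" "claims v b"
      using contested_claims[OF x(1,3,4)] .
    have vx: "{v, x} \<in> E" using x(1) by (simp add: claims_def)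
    \<comment> \<open>The failed claim points from \<open>v\<close> towards \<open>r\<close>. Every
      other claim of \<open>v\<close> then points away from \<open>r\<close> and is good.\<close>
    have "r \<in> br v x" using branch_opposite[OF vx] branch_opposite[OF adj_sym[OF vx]] x(2) r by blast
    have "good v c" if "c \<noteq> x" "claims v c" for c
    proof -
      have vc: "{v, c} \<in> E" using that(2) by (simp add: claims_def)
      have "r \<notin> br v c" using branch_disjoint[OF vx vc] that(1) \<open>r \<in> br v x\<close> by blast
      then have "r \<in> br c v" using branch_opposite[OF vc] r by blast
      then show ?thesis using that(2) by (simp add: good_def)
    qed
    then show ?thesis using ab by blast
  next
    case False
    have "V \<noteq> {v}" using V r by (metis DiffD1 singletonD)
    then show ?thesis using two_claims[OF v] False by metis
  qed
  show ?thesis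
  proof (rule that[of own])
    fix m assume "m \<in> M"
    then show "own m \<in> V - \<Union>M \<and> (\<exists>x\<in>m. {own m, x} \<in> E)" by (rule own(1))
  next
    fix v assume v: "v \<in> V - \<Union>M"
    then obtain a b where ab: "a \<noteq> b" "good v a" "good v b" using two by blast
    then have cl: "claims v a" "claims v b" by (simp_all add: good_def)
    obtain a' where a': "{a, a'} \<in> M" "\<And>u. {a', u} \<in> E \<Longrightarrow> u = a" using claims_leaf_leg[OF cl(1)] by blast
    obtain b' where b': "{b, b'} \<in> M" "\<And>u. {b', u} \<in> E \<Longrightarrow> u = b" using claims_leaf_leg[OF cl(2)] by blast
    have "{a, a'} \<noteq> {b, b'}" using claim_unique[OF a'(1) _ _ cl] ab(1) by blast
    moreover have "own {a, a'} = v" "own {b, b'} = v"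
      using own(2)[OF a'(1) _ ab(2)] own(2)[OF b'(1) _ ab(3)] by simp_all
    moreover have "{v, a} \<in> E" "{v, b} \<in> E" using cl by (simp_all add: claims_def)
    ultimately show
      "\<exists>a a' b b'. leaf_leg T M own v a a' \<and> leaf_leg T M own v b b' \<and> {a, a'} \<noteq> {b, b'}"
      using a' b' unfolding leaf_leg_def by (intro exI[of _ a] exI[of _ a'] exI[of _ b] exI[of _ b']) simp
  qed
qed

end

section \<open>Counting edge open packings by leaf legs\<close>

text \<open>If both ends of \<open>e\<close> lay on further edges of the packing, \<open>e\<close>
  would be the middle edge joining two of them, which is forbidden.\<close>

lemma eop_set_private_vertex:
  assumes G: "simple_graph G" and B: "eop_set G B" and e: "e \<in> B"
  obtains x where "x \<in> e" "\<And>e'. e' \<in> B \<Longrightarrow> x \<in> e' \<Longrightarrow> e' = e"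
proof -
  have eE: "e \<in> gedges G" using B e by (auto simp: eop_set_def)
  obtain a b where ab: "e = {a, b}" using simple_graph_edgeE[OF G eE] by metis
  have "(\<forall>e'\<in>B. a \<in> e' \<longrightarrow> e' = e) \<or> (\<forall>e'\<in>B. b \<in> e' \<longrightarrow> e' = e)"
  proof (rule ccontr)
    assume "\<not> ?thesis"
    then obtain e1 e2 where e12: "e1 \<in> B" "a \<in> e1" "e1 \<noteq> e" "e2 \<in> B" "b \<in> e2" "e2 \<noteq> e" by blast
    have "e1 \<in> gedges G" using B e12(1) by (auto simp: eop_set_def)
    then have "b \<notin> e1"
      using simple_graph_edge_eq[OF G _ e12(2)] e12(3) ab eE simple_graph_adj_neq[OF G] by metis
    then have "e1 \<noteq> e2" using e12(5) by blast
    then show False using eop_setD[OF B e12(1,4) _ e12(2,5)] eE e12(3,6) ab by simp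
  qed
  then show ?thesis using that[of a] that[of b] ab by blast
qed

text \<open>Every edge of an edge open packing has an endvertex lying on no other edge of the packing. It
  is charged to the leg containing that vertex; if the vertex is a center, it is charged to
  a leaf leg of this center, which cannot meet the packing.\<close>

lemma card_eop_set_le_leaf_legs:
  assumes G: "simple_graph G" and M: "induced_matching G M" and B: "eop_set G B"
    and legs: "\<And>v. v \<in> gverts G - \<Union>M \<Longrightarrow> 
      \<exists>a a' b b'. leaf_leg G M own v a a' \<and> leaf_leg G M own v b b' \<and> {a, a'} \<noteq> {b, b'}"
  shows "card B \<le> card M"
proof -
  have ME: "m \<in> M \<Longrightarrow> m \<in> gedges G" for m using M by (auto simp: induced_matching_iff)
  have BE: "e \<in> B \<Longrightarrow> e \<in> gedges G" for e using B by (auto simp: eop_set_def)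
  define P where "P e m \<longleftrightarrow> m \<in> M \<and> (\<exists>x\<in>e. (\<forall>e'\<in>B. x \<in> e' \<longrightarrow> e' = e) \<and>
      (x \<in> m \<or> own m = x \<and> m \<inter> \<Union>B = {}))" for e m
  have "\<exists>m. P e m" if e: "e \<in> B" for e
  proof -
    obtain x where x: "x \<in> e" "\<And>e'. e' \<in> B \<Longrightarrow> x \<in> e' \<Longrightarrow> e' = e"
      using eop_set_private_vertex[OF G B e] by blast
    show ?thesis
    proof (cases "x \<in> \<Union>M")
      case True
      then obtain m where "m \<in> M" "x \<in> m" by (rule UnionE)
      then show ?thesis using x unfolding P_def by blast
    next
      case False
      obtain z where z: "e = {x, z}" using simple_graph_edge_other[OF G BE[OF e] x(1)] by metis
      \<comment> \<open>If a packing edge \<open>e'\<close> contained \<open>a\<close>, then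
        \<open>xa\<close> would join \<open>e\<close> to \<open>e'\<close> and hence equal
        \<open>e'\<close>, although \<open>x\<close> is private to \<open>e\<close>. An edge at the
        leaf \<open>a'\<close> also contains \<open>a\<close>.\<close>
      have untouched: "{a, a'} \<inter> \<Union>B = {}"
        if leg: "leaf_leg G M own x a a'" and az: "a \<noteq> z" for a a'
      proof -
        have xa: "{x, a} \<in> gedges G" and a': "\<And>u. {a', u} \<in> gedges G \<Longrightarrow> u = a"
          using leg by (simp_all add: leaf_leg_def)
        have "a \<notin> \<Union>B"
        proof
          assume "a \<in> \<Union>B"
          then obtain e' where e': "e' \<in> B" "a \<in> e'" by (rule UnionE)
          have "a \<notin> e" using az simple_graph_adj_neq[OF G xa] z by simp
          then have "{x, a} = e \<or> {x, a} = e'"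
            using eop_setD[OF B e e'(1) _ x(1) e'(2) xa] e'(2) by metis
          then have "x \<in> e'" using \<open>a \<notin> e\<close> by auto
          then show False using x(2)[OF e'(1)] e'(2) \<open>a \<notin> e\<close> by simp
        qed
        moreover have "a' \<notin> \<Union>B"
        proof
          assume "a' \<in> \<Union>B"
          then obtain e' where e': "e' \<in> B" "a' \<in> e'" by (rule UnionE)
          obtain u where "e' = {a', u}" using simple_graph_edge_other[OF G BE[OF e'(1)] e'(2)] by metis
          then have "a \<in> e'" using a'[of u] BE[OF e'(1)] by simp
          then show False using \<open>a \<notin> \<Union>B\<close> e'(1) by (meson UnionI)
        qed
        ultimately show ?thesis by simp
      qed
      have "x \<in> gverts G - \<Union>M" using False BE[OF e] z simple_graph_adj_verts[OF G, of x z] by simp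
      then obtain a a' b b' where ab: "leaf_leg G M own x a a'" "leaf_leg G M own x b b'"
        "{a, a'} \<noteq> {b, b'}" using legs by blast
      then have M': "{a, a'} \<in> M" "{b, b'} \<in> M" "own {a, a'} = x" "own {b, b'} = x"
        by (simp_all add: leaf_leg_def)
      \<comment> \<open>The edge \<open>xz\<close> itself can use only one of the two legs, so the
        other one is free to be charged.\<close>
      have "a \<noteq> z \<or> b \<noteq> z"
        using ab(3) induced_matching_unique[OF M M'(1,2), of z] by auto
      then obtain m where "m \<in> M" "own m = x" "m \<inter> \<Union>B = {}"
        using untouched[OF ab(1)] untouched[OF ab(2)] M' by metis
      then show ?thesis using x unfolding P_def by blast
    qed
  qed
  then obtain \<phi> where \<phi>: "P e (\<phi> e)" if "e \<in> B" for e by metis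
  \<comment> \<open>If two edges share a charge, the leg meets the packing and so is not charged
    through its owner. It then joins the two private vertices, hence is one of the two edges, and
    one private vertex lies on both.\<close>
  have "inj_on \<phi> B"
  proof (rule inj_onI, rule ccontr)
    fix e e' assume e: "e \<in> B" "e' \<in> B" "\<phi> e = \<phi> e'" "e \<noteq> e'"
    let ?m = "\<phi> e"
    obtain x where x: "x \<in> e" "\<And>d. d \<in> B \<Longrightarrow> x \<in> d \<Longrightarrow> d = e" "x \<in> ?m \<or> own ?m = x \<and> ?m \<inter> \<Union>B = {}"
      using \<phi>[OF e(1)] unfolding P_def by blast
    obtain y where y: "y \<in> e'" "\<And>d. d \<in> B \<Longrightarrow> y \<in> d \<Longrightarrow> d = e'"
        "y \<in> ?m \<or> own ?m = y \<and> ?m \<inter> \<Union>B = {}"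
      using \<phi>[OF e(2)] unfolding P_def e(3) by blast
    have m: "?m \<in> gedges G" using \<phi>[OF e(1)] ME unfolding P_def by blast
    have "x \<noteq> y" using x(2)[OF e(2)] y(1) e(4) by metis
    moreover have "x \<in> \<Union>B" "y \<in> \<Union>B" using e x(1) y(1) by (meson UnionI)+
    ultimately have "x \<in> ?m" "y \<in> ?m" using x(3) y(3) by (metis disjoint_iff)+
    then have mxy: "?m = {x, y}" using simple_graph_edge_eq[OF G m] \<open>x \<noteq> y\<close> by metis
    then have "{x, y} = e \<or> {x, y} = e'" using eop_setD[OF B e(1,2,4) x(1) y(1)] m by simp
    then have "y \<in> e \<or> x \<in> e'" by blast
    then show False using x(2)[OF e(2)] y(2)[OF e(1)] e(4) by metis
  qed
  moreover have "\<phi> ` B \<subseteq> M" using \<phi> unfolding P_def by blast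
  moreover have "finite M" using simple_graph_finite_edges[OF G] ME by (meson finite_subset subsetI)
  ultimately show ?thesis using card_inj_on_le by blast
qed

lemma eop_number_eq_induced_matching_number:
  assumes G: "simple_graph G" and M: "induced_matching G M"
    and le: "\<And>B. eop_set G B \<Longrightarrow> card B \<le> card M"
  shows "\<rho>\<^sub>e\<^sup>o G = \<nu>\<^sub>I G"
proof -
  obtain B where "eop_set G B" "card B = \<rho>\<^sub>e\<^sup>o G" using eop_number_attained[OF G] .
  then have "\<rho>\<^sub>e\<^sup>o G \<le> card M" using le by metis
  also have "\<dots> \<le> \<nu>\<^sub>I G" by (rule card_le_induced_matching_number[OF G M])
  finally show ?thesis using induced_matching_number_le_eop_number[OF G] by simp
qed

section \<open>Isomorphism invariance\<close>

text \<open>Isomorphic graphs are treated as equal to such an image under a map injective on the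
  vertices. Invariance of the numbers then follows by transport along the map and along its
  inverse.\<close>

definition map_graph :: "('a \<Rightarrow> 'b) \<Rightarrow> 'a ugraph \<Rightarrow> 'b ugraph" where
  "map_graph f G = (f ` gverts G, (`) f ` gedges G)"

lemma map_graph_edgeI: "{u, v} \<in> gedges G \<Longrightarrow> {f u, f v} \<in> gedges (map_graph f G)"
  unfolding map_graph_def by (auto intro: image_eqI[of _ _ "{u, v}"])

lemma map_graph_edge_iff:
  assumes "simple_graph G" "inj_on f (gverts G)" "u \<in> gverts G" "v \<in> gverts G"
  shows "{f u, f v} \<in> gedges (map_graph f G) \<longleftrightarrow> {u, v} \<in> gedges G"
proof
  assume "{f u, f v} \<in> gedges (map_graph f G)"
  then obtain e where e: "e \<in> gedges G" "f ` {u, v} = f ` e" by (auto simp: map_graph_def)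
  have "e \<subseteq> gverts G" using assms(1) e(1) by (simp add: simple_graph_def)
  then have "{u, v} = e" using inj_on_image_eq_iff[OF assms(2), of "{u, v}" e] e(2) assms(3,4) by simp
  then show "{u, v} \<in> gedges G" using e(1) by simp
qed (rule map_graph_edgeI)

lemma map_graph_iso:
  assumes "simple_graph G" "inj_on f (gverts G)"
  shows "G \<simeq>\<^sub>g map_graph f G"
  unfolding graph_iso_def
proof (intro exI[of _ f] conjI ballI)
  show "bij_betw f (gverts G) (gverts (map_graph f G))"
    using assms(2) by (simp add: map_graph_def bij_betw_def)
qed (rule map_graph_edge_iff[OF assms, symmetric])

lemma graph_isoE:
  assumes G: "simple_graph G" and H: "simple_graph H" and "G \<simeq>\<^sub>g H"
  obtains f where "inj_on f (gverts G)" "H = map_graph f G"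
proof -
  obtain f where "bij_betw f (gverts G) (gverts H)" and f3:
    "\<forall>u\<in>gverts G. \<forall>v\<in>gverts G. {u, v} \<in> gedges G \<longleftrightarrow> {f u, f v} \<in> gedges H"
    using assms(3) unfolding graph_iso_def by (elim exE conjE)
  then have f: "inj_on f (gverts G)" "f ` gverts G = gverts H"
    "\<And>u v. u \<in> gverts G \<Longrightarrow> v \<in> gverts G \<Longrightarrow> {u, v} \<in> gedges G \<longleftrightarrow> {f u, f v} \<in> gedges H"
    by (simp_all add: bij_betw_def)
  have "gedges H = (`) f ` gedges G"
  proof (intro equalityI subsetI)
    fix e assume e: "e \<in> gedges H"
    then obtain a b where ab: "e = {a, b}" using simple_graph_edgeE[OF H] by metis
    then have "a \<in> f ` gverts G" "b \<in> f ` gverts G"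
      using simple_graph_adj_verts[OF H, of a b] e f(2) by auto
    then obtain u v where "u \<in> gverts G" "v \<in> gverts G" "a = f u" "b = f v" by blast
    then show "e \<in> (`) f ` gedges G" using f(3) e ab by (intro image_eqI[of _ _ "{u, v}"]) auto
  next
    fix e assume "e \<in> (`) f ` gedges G"
    then obtain d where d: "d \<in> gedges G" "e = f ` d" by blast
    then obtain u v where "d = {u, v}" using simple_graph_edgeE[OF G] by metis
    then show "e \<in> gedges H" using f(3)[of u v] d simple_graph_adj_verts[OF G, of u v] by auto
  qed
  then show ?thesis using that[of f] f(1,2) by (simp add: map_graph_def prod_eq_iff)
qed

lemma map_graph_simple:
  assumes "simple_graph G" "inj_on f (gverts G)"
  shows "simple_graph (map_graph f G)"
  unfolding simple_graph_def
proof (intro conjI ballI)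
  show "finite (gverts (map_graph f G))" using assms(1) by (simp add: simple_graph_def map_graph_def)
  fix d assume "d \<in> gedges (map_graph f G)"
  then obtain e where e: "e \<in> gedges G" "d = f ` e" unfolding map_graph_def by auto
  then have "e \<subseteq> gverts G" "card e = 2" using assms(1) by (simp_all add: simple_graph_def)
  then show "d \<subseteq> gverts (map_graph f G)" "card d = 2"
    using e(2) card_image[OF inj_on_subset[OF assms(2)]] by (auto simp: map_graph_def)
qed

lemma map_graph_inverse:
  assumes "simple_graph G" "inj_on f (gverts G)"
  defines "g \<equiv> inv_into (gverts G) f"
  shows "inj_on g (gverts (map_graph f G))" "map_graph g (map_graph f G) = G"
proof -
  show "inj_on g (gverts (map_graph f G))"
    by (simp add: g_def map_graph_def inj_on_inv_into)
  have gf: "g ` f ` S = S" if "S \<subseteq> gverts G" for S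
    unfolding g_def using inv_into_image_cancel[OF assms(2) that] .
  have "(`) g ` (`) f ` gedges G = (\<lambda>e. e) ` gedges G"
    unfolding image_image[of "(`) g"]
  proof (rule image_cong[OF refl])
    fix e assume "e \<in> gedges G"
    then have "e \<subseteq> gverts G" using assms(1) by (simp add: simple_graph_def)
    then show "g ` f ` e = e" by (rule gf)
  qed
  then show "map_graph g (map_graph f G) = G"
    unfolding map_graph_def fst_conv snd_conv gf[OF order_refl] by simp
qed

lemma map_graph_connected:
  assumes "connected_graph G"
  shows "connected_graph (map_graph f G)"
proof -
  have "(f u, f v) \<in> (adj_rel (map_graph f G))\<^sup>*" if "(u, v) \<in> (adj_rel G)\<^sup>*" for u v
    using that
  proof induction
    case (step y z)
    then show ?case
      using map_graph_edgeI[of y z G f] unfolding adj_rel_def by (auto intro: rtrancl_into_rtrancl)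
  qed simp
  then show ?thesis using assms by (auto simp: connected_graph_def map_graph_def)
qed

lemma map_graph_cycle:
  assumes G: "simple_graph G" and f: "inj_on f (gverts G)" and c: "graph_cycle G c"
  shows "graph_cycle (map_graph f G) (map f c)"
proof -
  have c': "length c \<ge> 3" "distinct c" "\<And>i. Suc i < length c \<Longrightarrow> {c ! i, c ! Suc i} \<in> gedges G"
    "{last c, hd c} \<in> gedges G" using c by (auto simp: graph_cycle_def)
  have "c \<noteq> []" using c'(1) by auto
  have "set c \<subseteq> gverts G"
  proof
    fix x assume "x \<in> set c"
    then obtain i where i: "i < length c" "x = c ! i" by (metis in_set_conv_nth)
    show "x \<in> gverts G"
    proof (cases "Suc i < length c")
      case True
      then show ?thesis using simple_graph_adj_verts[OF G c'(3)] i(2) by simp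
    next
      case False
      then have "x = last c" using i last_conv_nth[OF \<open>c \<noteq> []\<close>]
        by (metis Suc_lessI diff_Suc_1)
      then show ?thesis using simple_graph_adj_verts[OF G c'(4)] by simp
    qed
  qed
  then show ?thesis
    using c' \<open>c \<noteq> []\<close> f unfolding graph_cycle_def
    by (auto simp: distinct_map inj_on_subset last_map hd_map map_graph_edgeI)
qed

lemma map_graph_tree:
  assumes G: "tree_graph G" and f: "inj_on f (gverts G)"
  shows "tree_graph (map_graph f G)"
proof -
  have s: "simple_graph G" using G by (simp add: tree_graph_def)
  note inv = map_graph_inverse[OF s f]
  \<comment> \<open>A cycle of the image is carried back to \<open>G\<close> by the inverse
    map.\<close>
  have "\<not> graph_cycle (map_graph f G) c" for c
    using map_graph_cycle[OF map_graph_simple[OF s f] inv(1), of c] inv(2) G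
    by (auto simp: tree_graph_def)
  moreover have "connected_graph (map_graph f G)"
    using G by (intro map_graph_connected) (simp add: tree_graph_def)
  ultimately show ?thesis using map_graph_simple[OF s f] by (simp add: tree_graph_def)
qed

lemma map_graph_edge_pullback:
  assumes G: "simple_graph G" and f: "inj_on f (gverts G)"
    and e: "e\<^sub>1 \<in> gedges G" "e\<^sub>2 \<in> gedges G" "x \<in> f ` e\<^sub>1" "y \<in> f ` e\<^sub>2"
      "{x, y} \<in> gedges (map_graph f G)"
  obtains u v where "u \<in> e\<^sub>1" "v \<in> e\<^sub>2" "x = f u" "y = f v" "{u, v} \<in> gedges G"
proof -
  from e(3) obtain u where u: "u \<in> e\<^sub>1" "x = f u" by blast
  from e(4) obtain v where v: "v \<in> e\<^sub>2" "y = f v" by blast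
  have "u \<in> gverts G" "v \<in> gverts G" using u(1) v(1) e(1,2) G by (auto simp: simple_graph_def)
  then have "{u, v} \<in> gedges G" using map_graph_edge_iff[OF G f] e(5) u(2) v(2) by simp
  then show ?thesis using that u v by blast
qed

lemma map_graph_card_edges:
  assumes G: "simple_graph G" and f: "inj_on f (gverts G)" and B: "B \<subseteq> gedges G"
  shows "card ((`) f ` B) = card B"
proof (rule card_image)
  have "B \<subseteq> Pow (gverts G)" using B G by (auto simp: simple_graph_def)
  then show "inj_on ((`) f) B" using inj_on_image_Pow[OF f] inj_on_subset by blast
qed

lemma map_graph_eop_set:
  assumes G: "simple_graph G" and f: "inj_on f (gverts G)" and B: "eop_set G B"
  shows "eop_set (map_graph f G) ((`) f ` B)"
proof (rule eop_setI)
  have BE: "B \<subseteq> gedges G" using B by (simp add: eop_set_def)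
  then show "(`) f ` B \<subseteq> gedges (map_graph f G)" by (auto simp: map_graph_def)
  fix d\<^sub>1 d\<^sub>2 x y
  assume *: "d\<^sub>1 \<in> (`) f ` B" "d\<^sub>2 \<in> (`) f ` B" "d\<^sub>1 \<noteq> d\<^sub>2" "x \<in> d\<^sub>1" "y \<in> d\<^sub>2"
    "{x, y} \<in> gedges (map_graph f G)"
  from *(1) obtain e\<^sub>1 where e1: "e\<^sub>1 \<in> B" "d\<^sub>1 = f ` e\<^sub>1" by blast
  from *(2) obtain e\<^sub>2 where e2: "e\<^sub>2 \<in> B" "d\<^sub>2 = f ` e\<^sub>2" by blast
  obtain u v where uv: "u \<in> e\<^sub>1" "v \<in> e\<^sub>2" "x = f u" "y = f v" "{u, v} \<in> gedges G"
    using map_graph_edge_pullback[OF G f _ _ _ _ *(6), of e\<^sub>1 e\<^sub>2] e1 e2 *(4,5) BE by blast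
  have "e\<^sub>1 \<noteq> e\<^sub>2" using e1(2) e2(2) *(3) by blast
  then have "{u, v} = e\<^sub>1 \<or> {u, v} = e\<^sub>2" using eop_setD[OF B e1(1) e2(1) _ uv(1,2,5)] by simp
  moreover have "{x, y} = f ` {u, v}" using uv(3,4) by simp
  ultimately show "{x, y} = d\<^sub>1 \<or> {x, y} = d\<^sub>2" using e1(2) e2(2) by metis
qed

lemma map_graph_induced_matching:
  assumes G: "simple_graph G" and f: "inj_on f (gverts G)" and M: "induced_matching G M"
  shows "induced_matching (map_graph f G) ((`) f ` M)"
  unfolding induced_matching_iff
proof (intro conjI ballI impI)
  have ME: "M \<subseteq> gedges G" using M by (simp add: induced_matching_iff)
  then show "(`) f ` M \<subseteq> gedges (map_graph f G)" by (auto simp: map_graph_def)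
  fix d\<^sub>1 d\<^sub>2 assume *: "d\<^sub>1 \<in> (`) f ` M" "d\<^sub>2 \<in> (`) f ` M" "d\<^sub>1 \<noteq> d\<^sub>2"
  from *(1) obtain e\<^sub>1 where e1: "e\<^sub>1 \<in> M" "d\<^sub>1 = f ` e\<^sub>1" by blast
  from *(2) obtain e\<^sub>2 where e2: "e\<^sub>2 \<in> M" "d\<^sub>2 = f ` e\<^sub>2" by blast
  have ne: "e\<^sub>1 \<noteq> e\<^sub>2" using e1(2) e2(2) *(3) by blast
  have sub: "e\<^sub>1 \<subseteq> gverts G" "e\<^sub>2 \<subseteq> gverts G" using e1(1) e2(1) ME G by (auto simp: simple_graph_def)
  have "e\<^sub>1 \<inter> e\<^sub>2 = {}" using ne M e1(1) e2(1) unfolding induced_matching_iff by blast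
  then show "d\<^sub>1 \<inter> d\<^sub>2 = {}" using inj_on_image_Int[OF f sub] e1(2) e2(2) by simp
  fix x y assume xy: "x \<in> d\<^sub>1" "y \<in> d\<^sub>2"
  show "{x, y} \<notin> gedges (map_graph f G)"
  proof
    assume "{x, y} \<in> gedges (map_graph f G)"
    then obtain u v where uv: "u \<in> e\<^sub>1" "v \<in> e\<^sub>2" "{u, v} \<in> gedges G"
      using map_graph_edge_pullback[OF G f, of e\<^sub>1 e\<^sub>2 x y] e1 e2 xy ME by blast
    then show False using induced_matching_adj[OF M e1(1) e2(1) uv] ne by simp
  qed
qed

lemma eop_number_le_map_graph:
  assumes G: "simple_graph G" and f: "inj_on f (gverts G)"
  shows "\<rho>\<^sub>e\<^sup>o G \<le> \<rho>\<^sub>e\<^sup>o (map_graph f G)"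
proof -
  obtain B where B: "eop_set G B" "card B = \<rho>\<^sub>e\<^sup>o G" using eop_number_attained[OF G] .
  then have "card ((`) f ` B) = \<rho>\<^sub>e\<^sup>o G"
    using map_graph_card_edges[OF G f, of B] by (simp add: eop_set_def)
  then show ?thesis
    using card_le_eop_number[OF map_graph_simple[OF G f] map_graph_eop_set[OF G f B(1)]] by simp
qed

lemma induced_matching_number_le_map_graph:
  assumes G: "simple_graph G" and f: "inj_on f (gverts G)"
  shows "\<nu>\<^sub>I G \<le> \<nu>\<^sub>I (map_graph f G)"
proof -
  obtain M where M: "induced_matching G M" "card M = \<nu>\<^sub>I G"
    using induced_matching_number_attained[OF G] .
  then have "card ((`) f ` M) = \<nu>\<^sub>I G"
    using map_graph_card_edges[OF G f, of M] by (simp add: induced_matching_iff)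
  then show ?thesis
    using card_le_induced_matching_number[OF map_graph_simple[OF G f]
        map_graph_induced_matching[OF G f M(1)]] by simp
qed

lemma graph_iso_numbers:
  assumes G: "simple_graph G" and H: "simple_graph H" and "G \<simeq>\<^sub>g H"
  shows "\<rho>\<^sub>e\<^sup>o G = \<rho>\<^sub>e\<^sup>o H" "\<nu>\<^sub>I G = \<nu>\<^sub>I H"
proof -
  obtain f where f: "inj_on f (gverts G)" "H = map_graph f G" using graph_isoE[OF assms] .
  obtain g where "inj_on g (gverts H)" "map_graph g H = G"
    using map_graph_inverse[OF G f(1)] unfolding f(2)[symmetric] by (rule that)
  then show "\<rho>\<^sub>e\<^sup>o G = \<rho>\<^sub>e\<^sup>o H" "\<nu>\<^sub>I G = \<nu>\<^sub>I H"
    using eop_number_le_map_graph[OF G f(1)] eop_number_le_map_graph[OF H, of g]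
      induced_matching_number_le_map_graph[OF G f(1)]
      induced_matching_number_le_map_graph[OF H, of g] f(2) by simp_all
qed

section \<open>The family of trees built from spiders\<close>

lemma gdegree_1_unique:
  "\<lbrakk>gdegree G v = 1; e \<in> gedges G; e' \<in> gedges G; v \<in> e; v \<in> e'\<rbrakk> \<Longrightarrow> e = e'"
  unfolding gdegree_def by (metis (mono_tags, lifting) card_1_singletonE mem_Collect_eq singletonD)

lemma gdegree_1I:
  assumes "e \<in> gedges G" "v \<in> e" "\<And>e'. e' \<in> gedges G \<Longrightarrow> v \<in> e' \<Longrightarrow> e' = e"
  shows "gdegree G v = 1"
proof -
  have "{e \<in> gedges G. v \<in> e} = {e}" using assms by blast
  then show ?thesis by (simp add: gdegree_def)
qed

lemma spider_edge_iff:
  "e \<in> gedges (spider k) \<longleftrightarrow> (\<exists>j<k. e = {Center, Mid j} \<or> e = {Mid j, Tip j})"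
  by (auto simp: spider_def)

text \<open>The bound on \<open>k\<close> matters for the center, which would be a leaf as well if
  \<open>k = 1\<close>.\<close>

lemma gleaves_spider:
  assumes "k \<ge> 2"
  shows "gleaves (spider k) = Tip ` {..<k}"
proof (intro equalityI subsetI)
  fix x assume "x \<in> gleaves (spider k)"
  then have x: "x \<in> gverts (spider k)" "gdegree (spider k) x = 1" by (simp_all add: gleaves_def)
  show "x \<in> Tip ` {..<k}"
  proof (cases x)
    case Center
    have "{Center, Mid 0} \<in> gedges (spider k)" "{Center, Mid 1} \<in> gedges (spider k)"
      using assms unfolding spider_edge_iff by force+
    then have "{Center, Mid 0} = {Center, Mid 1}" using gdegree_1_unique[OF x(2)] Center by simp
    then show ?thesis by (simp add: doubleton_eq_iff)
  next
    case (Mid j)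
    then have "j < k" using x(1) by (auto simp: spider_def)
    then have "{Center, Mid j} \<in> gedges (spider k)" "{Mid j, Tip j} \<in> gedges (spider k)"
      unfolding spider_edge_iff by blast+
    then have "{Center, Mid j} = {Mid j, Tip j}" using gdegree_1_unique[OF x(2)] Mid by simp
    then show ?thesis by (simp add: doubleton_eq_iff)
  next
    case (Tip j)
    then show ?thesis using x(1) by (auto simp: spider_def)
  qed
next
  fix x assume "x \<in> Tip ` {..<k}"
  then obtain j where j: "j < k" "x = Tip j" by blast
  have "gdegree (spider k) (Tip j) = 1"
    by (rule gdegree_1I[of "{Mid j, Tip j}"]) (use j(1) in \<open>auto simp: spider_edge_iff\<close>)
  then show "x \<in> gleaves (spider k)" using j by (auto simp: gleaves_def spider_def)
qed

lemma card_spider: "card (gverts (spider k)) = Suc (card (gedges (spider k)))"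
proof -
  have "card (Mid ` {..<k} \<union> Tip ` {..<k}) = k + k"
    by (subst card_Un_disjoint) (auto simp: card_image inj_on_def)
  moreover have "gverts (spider k) = insert Center (Mid ` {..<k} \<union> Tip ` {..<k})"
    by (simp add: spider_def)
  ultimately have "card (gverts (spider k)) = Suc (k + k)"
    by (simp add: image_iff)
  moreover have "gedges (spider k) = (\<lambda>j. {Center, Mid j}) ` {..<k} \<union> (\<lambda>j. {Mid j, Tip j}) ` {..<k}"
    by (auto simp: spider_def)
  moreover have "card \<dots> = k + k"
    by (subst card_Un_disjoint) (auto simp: card_image inj_on_def doubleton_eq_iff)
  ultimately show ?thesis by simp
qed

abbreviation spiders :: "nat set \<Rightarrow> (nat \<Rightarrow> nat) \<Rightarrow> (nat \<times> spider_vertex) ugraph" where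
  "spiders I k \<equiv> disjoint_union_graph I (\<lambda>i. spider (k i))"

lemma spiders_verts [simp]:
  "(i, Center) \<in> gverts (spiders I k) \<longleftrightarrow> i \<in> I"
  "(i, Mid j) \<in> gverts (spiders I k) \<longleftrightarrow> i \<in> I \<and> j < k i"
  "(i, Tip j) \<in> gverts (spiders I k) \<longleftrightarrow> i \<in> I \<and> j < k i"
  by (auto simp: disjoint_union_graph_def spider_def)

lemma spiders_edge_iff:
  "e \<in> gedges (spiders I k) \<longleftrightarrow>
    (\<exists>i\<in>I. \<exists>j<k i. e = {(i, Center), (i, Mid j)} \<or> e = {(i, Mid j), (i, Tip j)})"
proof -
  have "e \<in> gedges (spiders I k) \<longleftrightarrow> (\<exists>i\<in>I. \<exists>d. d \<in> gedges (spider (k i)) \<and> e = Pair i ` d)"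
    by (auto simp: disjoint_union_graph_def)
  moreover have "(\<exists>d. d \<in> gedges (spider (k i)) \<and> e = Pair i ` d) \<longleftrightarrow>
      (\<exists>j<k i. e = Pair i ` {Center, Mid j} \<or> e = Pair i ` {Mid j, Tip j})" for i
    unfolding spider_edge_iff by blast
  ultimately show ?thesis by simp
qed

lemma finite_spiders: "finite I \<Longrightarrow> finite (gverts (spiders I k))"
  by (simp add: disjoint_union_graph_def spider_def)

text \<open>Each spider has one vertex more than edges. Compared with \<open>card_edges\<close> for
  a tree on the same vertices, this determines how many edges have to be added.\<close>

lemma card_spiders:
  assumes "finite I"
  shows "card (gverts (spiders I k)) = card (gedges (spiders I k)) + card I"
proof -
  have fin: "finite (gverts (spider j))" "finite (gedges (spider j))" for j
    by (simp_all add: spider_def)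
  have inj: "inj (Pair i)" for i :: nat by (simp add: inj_on_def)
  have im: "card ((`) (Pair i) ` X) = card X" for i :: nat and X :: "spider_vertex set set"
    by (rule card_image) (auto simp: inj_on_def inj_image_eq_iff[OF inj])
  have ne: "{} \<notin> gedges (spider j)" for j by (auto simp: spider_def)
  have "card (gedges (spiders I k)) = (\<Sum>i\<in>I. card ((`) (Pair i) ` gedges (spider (k i))))"
    unfolding disjoint_union_graph_def snd_conv
  proof (rule card_UN_disjoint[OF assms])
    show "\<forall>i\<in>I. finite ((`) (Pair i) ` gedges (spider (k i)))" using fin by simp
    show "\<forall>i\<in>I. \<forall>i'\<in>I. i \<noteq> i' \<longrightarrow>
        (`) (Pair i) ` gedges (spider (k i)) \<inter> (`) (Pair i') ` gedges (spider (k i')) = {}"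
    proof (intro ballI impI equals0I)
      fix i i' d assume "i \<noteq> i'"
        and "d \<in> (`) (Pair i) ` gedges (spider (k i)) \<inter> (`) (Pair i') ` gedges (spider (k i'))"
      then obtain e e' where e: "e \<in> gedges (spider (k i))" "Pair i ` e = Pair i' ` e'" by blast
      then obtain x where "x \<in> e" using ne by (metis equals0I)
      then have "(i, x) \<in> Pair i' ` e'" using e(2) by blast
      then show False using \<open>i \<noteq> i'\<close> by blast
    qed
  qed
  moreover have "card (gverts (spiders I k)) = (\<Sum>i\<in>I. card (gverts (spider (k i))))"
    unfolding disjoint_union_graph_def fst_conv using assms fin by (simp add: card_SigmaI)
  ultimately show ?thesis
    by (simp add: im card_spider sum.distrib[symmetric] sum_Suc)
qed

lemma family_F_tree: "F \<in> family_F \<Longrightarrow> tree_graph F"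
  unfolding family_F_def by blast

section \<open>Equality of the two numbers for members of the family\<close>

lemma family_F_numbers:
  assumes "F \<in> family_F"
  shows "\<rho>\<^sub>e\<^sup>o F = \<nu>\<^sub>I F"
proof -
  from assms obtain n k A where k: "\<forall>i\<in>{1..n}. k i \<ge> 2"
    and F: "F = add_edges (spiders {1..n} k) A" and tree: "tree_graph F"
    and C1: "\<forall>e\<in>A. \<exists>i\<in>{1..n}. (i, Center) \<in> e"
    and C2: "\<forall>i\<in>{1..n}. \<exists>x\<in>gleaves (spider (k i)). \<exists>y\<in>gleaves (spider (k i)).
           x \<noteq> y \<and> gdegree F (i, x) = 1 \<and> gdegree F (i, y) = 1"
    unfolding family_F_def by blast
  let ?I = "{1..n}"
  have s: "simple_graph F" using tree by (simp add: tree_graph_def)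
  have V: "gverts F = gverts (spiders ?I k)" and E: "gedges F = gedges (spiders ?I k) \<union> A"
    by (simp_all add: F add_edges_def)
  define leg where "leg i j = {(i, Mid j), (i, Tip j)}" for i j :: nat
  define M where "M = {leg i j | i j. i \<in> ?I \<and> j < k i}"
  \<comment> \<open>The owner has to be a function of the edge alone; both ends of a leg carry the
    index of its spider, so any choice of end gives the same center.\<close>
  define own where "own m = (fst (SOME p. p \<in> m), Center)" for m :: "(nat \<times> spider_vertex) set"
  have ME: "M \<subseteq> gedges F" 
  proof
    fix m assume "m \<in> M"
    then obtain i j where "i \<in> ?I" "j < k i" "m = {(i, Mid j), (i, Tip j)}"
      unfolding M_def leg_def by blast
    then have "m \<in> gedges (spiders ?I k)" unfolding spiders_edge_iff by blast
    then show "m \<in> gedges F" by (simp add: E)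
  qed
  have noC: "(i, Center) \<notin> m" if "m \<in> M" for i m using that by (auto simp: M_def leg_def)
  \<comment> \<open>For spider edges this holds by construction, for added edges by condition (C1).
    It makes the legs an induced matching, because legs contain no center.\<close>
  have EM: "e \<in> M \<or> (\<exists>i. (i, Center) \<in> e)" if "e \<in> gedges F" for e
    using that C1 unfolding E M_def leg_def by (auto simp: spiders_edge_iff)
  have disj: "m = m'" if "m \<in> M" "m' \<in> M" "p \<in> m" "p \<in> m'" for m m' p
    using that by (auto simp: M_def leg_def)
  have im: "induced_matching F M"
    unfolding induced_matching_iff
  proof (intro conjI ballI impI ME)
    fix m m' assume m: "m \<in> M" "m' \<in> M" "m \<noteq> m'"
    show "m \<inter> m' = {}" using disj m by blast
    fix x y assume xy: "x \<in> m" "y \<in> m'"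
    show "{x, y} \<notin> gedges F"
    proof
      assume "{x, y} \<in> gedges F"
      then have "{x, y} \<in> M" using EM[of "{x, y}"] noC m xy by auto
      then have "{x, y} = m" "{x, y} = m'" using disj m xy by (metis insertI1 insertI2)+
      then show False using m(3) by simp
    qed
  qed
  have own: "own (leg i j) = (i, Center)" for i j
  proof -
    have "(SOME p. p \<in> leg i j) \<in> leg i j" by (rule someI[of _ "(i, Mid j)"]) (simp add: leg_def)
    then show ?thesis by (auto simp: own_def leg_def)
  qed
  have leaf: "leaf_leg F M own (i, Center) (i, Mid j) (i, Tip j)"
    if "i \<in> ?I" "j < k i" "gdegree F (i, Tip j) = 1" for i j
  proof -
    have m: "leg i j \<in> M" using that by (auto simp: M_def)
    have "u = (i, Mid j)" if "{(i, Tip j), u} \<in> gedges F" for u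
    proof -
      have "{(i, Tip j), u} = leg i j"
        by (rule gdegree_1_unique[OF \<open>gdegree F (i, Tip j) = 1\<close> that]) (use m ME in \<open>auto simp: leg_def\<close>)
      then show ?thesis by (auto simp: leg_def doubleton_eq_iff)
    qed
    moreover have "{(i, Center), (i, Mid j)} \<in> gedges F"
      using that unfolding E by (auto simp: spiders_edge_iff)
    ultimately show ?thesis using m own[of i j] by (simp add: leaf_leg_def leg_def)
  qed
  have legs: "\<exists>a a' b b'. leaf_leg F M own v a a' \<and> leaf_leg F M own v b b' \<and> {a, a'} \<noteq> {b, b'}"
    if v: "v \<in> gverts F - \<Union>M" for v
  proof -
    obtain i x where ix: "v = (i, x)" by (cases v)
    have "x = Center"
    proof (cases x)
      case (Mid j)
      then have "v \<in> leg i j" "leg i j \<in> M" using v ix by (auto simp: V M_def leg_def)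
      then show ?thesis using v by blast
    next
      case (Tip j)
      then have "v \<in> leg i j" "leg i j \<in> M" using v ix by (auto simp: V M_def leg_def)
      then show ?thesis using v by blast
    qed
    then have i: "i \<in> ?I" and v': "v = (i, Center)" using v ix V by auto
    \<comment> \<open>With the leaves of a spider identified, condition (C2) yields the two leaf
      legs required at each center.\<close>
    have tips: "gleaves (spider (k i)) = Tip ` {..<k i}" using gleaves_spider k i by blast
    obtain x y where xy: "x \<in> gleaves (spider (k i))" "y \<in> gleaves (spider (k i))" "x \<noteq> y"
      "gdegree F (i, x) = 1" "gdegree F (i, y) = 1" using bspec[OF C2 i] by blast
    from xy(1,2) obtain j j' where "j < k i" "x = Tip j" "j' < k i" "y = Tip j'"
      unfolding tips by blast
    with xy have j: "j < k i" "j' < k i" "j \<noteq> j'" "gdegree F (i, Tip j) = 1"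
      "gdegree F (i, Tip j') = 1" by simp_all
    have "{(i, Mid j), (i, Tip j)} \<noteq> {(i, Mid j'), (i, Tip j')}"
      using j(3) by (simp add: doubleton_eq_iff)
    then show ?thesis using leaf[OF i j(1,4)] leaf[OF i j(2,5)] v' by blast
  qed
  show ?thesis
    by (rule eop_number_eq_induced_matching_number[OF s im])
      (rule card_eop_set_le_leaf_legs[OF s im _ legs])
qed

section \<open>Realizing the tree as a member of the family\<close>

context induced_matching_tree
begin

lemma iso_family_F:
  assumes C: "V - \<Union>M \<noteq> {}"
    and own: "\<And>m. m \<in> M \<Longrightarrow> own m \<in> V - \<Union>M \<and> (\<exists>x\<in>m. {own m, x} \<in> E)"
    and legs: "\<And>v. v \<in> V - \<Union>M \<Longrightarrow>
      \<exists>a a' b b'. leaf_leg T M own v a a' \<and> leaf_leg T M own v b b' \<and> {a, a'} \<noteq> {b, b'}"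
  shows "\<exists>F\<in>family_F. T \<simeq>\<^sub>g F"
proof -
  let ?C = "V - \<Union>M" and ?I = "{1..card (V - \<Union>M)}"
  define n where "n = card ?C"
  have finC: "finite ?C" using finV by simp
  then have n: "n \<ge> 1" using C unfolding n_def by (simp add: Suc_le_eq card_gt_0_iff)
  obtain c where c: "bij_betw c {1..n} ?C"
    using ex_bij_betw_nat_finite_1[OF finC] unfolding n_def by blast
  define k where "k i = card {m \<in> M. own m = c i}" for i
  have "\<exists>f. bij_betw f {..<k i} {m \<in> M. own m = c i}" for i
    using ex_bij_betw_nat_finite[of "{m \<in> M. own m = c i}"] finM
    by (simp add: k_def lessThan_atLeast0)
  then obtain g where g: "bij_betw (g i) {..<k i} {m \<in> M. own m = c i}" for i by metis
  \<comment> \<open>Each leg is oriented: its middle vertex is an end adjacent to the owner, the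
    other end is the tip.\<close>
  have "\<exists>x y. {x, y} = m \<and> x \<noteq> y \<and> {own m, x} \<in> E" if "m \<in> M" for m
    using own[OF that] simple_graph_edge_other[OF simple M_edges[OF that]] by metis
  then obtain mid tip where mt: "{mid m, tip m} = m" "mid m \<noteq> tip m" "{own m, mid m} \<in> E"
    if "m \<in> M" for m by metis
  have cC: "c i \<in> ?C" if "i \<in> {1..n}" for i using c that by (auto simp: bij_betw_def)
  have gM: "g i j \<in> M" "own (g i j) = c i" if "j < k i" for i j
    using g[of i] that by (auto simp: bij_betw_def)
  have c_inj: "c i = c i' \<longleftrightarrow> i = i'" if "i \<in> {1..n}" "i' \<in> {1..n}" for i i'
    using c that by (auto simp: bij_betw_def inj_on_eq_iff)
  have g_inj: "g i j = g i' j' \<longleftrightarrow> i = i' \<and> j = j'"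
    if "i \<in> {1..n}" "i' \<in> {1..n}" "j < k i" "j' < k i'" for i i' j j'
  proof
    assume eq: "g i j = g i' j'"
    then have "i = i'" using gM(2)[OF that(3)] gM(2)[OF that(4)] c_inj[OF that(1,2)] by simp
    then show "i = i' \<and> j = j'"
      using inj_onD[OF bij_betw_imp_inj_on[OF g[of i]], of j j'] eq that(3,4) by simp
  qed simp
  have leg_index: "\<exists>i\<in>{1..n}. \<exists>j<k i. m = g i j" if "m \<in> M" for m
  proof -
    have "own m \<in> c ` {1..n}" using own[OF that] c by (simp add: bij_betw_def)
    then obtain i where i: "i \<in> {1..n}" "own m = c i" by blast
    then have "m \<in> g i ` {..<k i}" using g[of i] that by (simp add: bij_betw_def)
    then show ?thesis using i by blast
  qed
  have mtM: "mid m \<in> m" "tip m \<in> m" if "m \<in> M" for m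
  proof -
    have "mid m \<in> {mid m, tip m}" "tip m \<in> {mid m, tip m}" by simp_all
    then show "mid m \<in> m" "tip m \<in> m" unfolding mt(1)[OF that] .
  qed
  have mid_mid: "mid m = mid m' \<longleftrightarrow> m = m'" and tip_tip: "tip m = tip m' \<longleftrightarrow> m = m'"
    and mid_tip: "mid m \<noteq> tip m'" if m: "m \<in> M" "m' \<in> M" for m m'
  proof -
    note un = induced_matching_unique[OF M m, symmetric] and m1 = mtM[OF m(1)] and m2 = mtM[OF m(2)]
    show "mid m = mid m' \<longleftrightarrow> m = m'"
    proof
      assume "mid m = mid m'"
      then have "mid m \<in> m'" using m2(1) by simp
      then show "m = m'" by (rule un[OF m1(1)])
    qed simp
    show "tip m = tip m' \<longleftrightarrow> m = m'"
    proof
      assume "tip m = tip m'"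
      then have "tip m \<in> m'" using m2(2) by simp
      then show "m = m'" by (rule un[OF m1(2)])
    qed simp
    show "mid m \<noteq> tip m'"
    proof
      assume *: "mid m = tip m'"
      then have "mid m \<in> m'" using m2(2) by simp
      then have "m = m'" by (rule un[OF m1(1)])
      then show False using * mt(2)[OF m(1)] by simp
    qed
  qed
  have mid_c: "mid m \<noteq> c i" and tip_c: "tip m \<noteq> c i" if "m \<in> M" "i \<in> {1..n}" for m i
  proof -
    have "mid m \<in> \<Union>M" "tip m \<in> \<Union>M" using mtM[OF that(1)] that(1) by (meson UnionI)+
    then show "mid m \<noteq> c i" "tip m \<noteq> c i" using cC[OF that(2)] by (metis DiffD2)+
  qed
  define h where "h p = (case snd p of Center \<Rightarrow> c (fst p) | Mid j \<Rightarrow> mid (g (fst p) j)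
      | Tip j \<Rightarrow> tip (g (fst p) j))" for p
  have h [simp]: "h (i, Center) = c i" "h (i, Mid j) = mid (g i j)" "h (i, Tip j) = tip (g i j)"
    for i j by (simp_all add: h_def)
  define U where "U = spiders {1..n} k"
  define W where "W = gverts U"
  have W [simp]: "(i, Center) \<in> W \<longleftrightarrow> i \<in> {1..n}" "(i, Mid j) \<in> W \<longleftrightarrow> i \<in> {1..n} \<and> j < k i"
    "(i, Tip j) \<in> W \<longleftrightarrow> i \<in> {1..n} \<and> j < k i" for i j by (simp_all add: W_def U_def)
  have h_inj: "inj_on h W"
  proof (rule inj_onI)
    fix p q assume pq: "p \<in> W" "q \<in> W" "h p = h q"
    obtain i x where p: "p = (i, x)" by (cases p)
    obtain i' x' where q: "q = (i', x')" by (cases q)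
    show "p = q"
      using pq unfolding p q
      by (cases x; cases x')
        (simp_all add: c_inj g_inj gM(1) mid_mid tip_tip mid_tip mid_c tip_c
          mid_tip[symmetric] mid_c[symmetric] tip_c[symmetric])
  qed
  have hW: "h ` W = V"
  proof (intro equalityI subsetI)
    fix y assume "y \<in> h ` W"
    then obtain i x where x: "(i, x) \<in> W" "y = h (i, x)" by auto
    have sub: "m \<subseteq> V" if "m \<in> M" for m
      using M_edges[OF that] simple by (simp add: simple_graph_def)
    show "y \<in> V"
    proof (cases x)
      case Center
      then show ?thesis using x cC[of i] by simp
    next
      case (Mid j)
      then show ?thesis using x sub[OF gM(1), of j i] mtM[OF gM(1), of j i] by auto
    next
      case (Tip j)
      then show ?thesis using x sub[OF gM(1), of j i] mtM[OF gM(1), of j i] by auto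
    qed
  next
    fix y assume y: "y \<in> V"
    show "y \<in> h ` W"
    proof (cases "y \<in> \<Union>M")
      case True
      then obtain m where m: "m \<in> M" "y \<in> m" by (rule UnionE)
      obtain i j where ij: "i \<in> {1..n}" "j < k i" "m = g i j" using leg_index[OF m(1)] by blast
      have "y \<in> {mid m, tip m}" using mt(1)[OF m(1)] m(2) by simp
      then have "y = h (i, Mid j) \<or> y = h (i, Tip j)" using ij(3) by auto
      then show ?thesis using ij(1,2) W(2,3)[of i j] by (metis imageI)
    next
      case False
      then have "y \<in> c ` {1..n}" using c y by (simp add: bij_betw_def)
      then obtain i where "i \<in> {1..n}" "y = h (i, Center)" by auto
      then show ?thesis using W(1)[of i] by (metis imageI)
    qed
  qed
  \<comment> \<open>All edges of \<open>T\<close> are pulled back along the bijection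
    \<open>h\<close>. So \<open>F\<close> is a tree isomorphic to \<open>T\<close>, with the
    vertices of the spiders; what remains is to sort its edges.\<close>
  define F where "F = (W, {e. e \<subseteq> W \<and> h ` e \<in> E})"
  have F_edge: "e \<in> gedges F \<longleftrightarrow> e \<subseteq> W \<and> h ` e \<in> E" for e by (simp add: F_def)
  have FW: "gverts F = W" by (simp add: F_def)
  have finW: "finite W" unfolding W_def U_def by (rule finite_spiders) simp
  have sF: "simple_graph F"
    unfolding simple_graph_def FW
  proof (intro conjI ballI finW)
    fix e assume "e \<in> gedges F"
    then have e: "e \<subseteq> W" "h ` e \<in> E" by (simp_all add: F_edge)
    show "e \<subseteq> W" by (rule e(1))
    show "card e = 2"
      using card_image[OF inj_on_subset[OF h_inj e(1)]] e(2) simple by (simp add: simple_graph_def)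
  qed
  have "map_graph h F = T"
  proof -
    have "(`) h ` gedges F = E"
    proof (intro equalityI subsetI)
      fix e assume e: "e \<in> E"
      then have "e \<subseteq> h ` W" using simple hW by (simp add: simple_graph_def)
      then obtain d where "d \<subseteq> W" "e = h ` d" by (auto simp: subset_image_iff)
      then show "e \<in> (`) h ` gedges F" using e by (intro image_eqI[of _ _ d]) (simp_all add: F_edge)
    next
      fix e assume "e \<in> (`) h ` gedges F"
      then show "e \<in> E" by (auto simp: F_edge)
    qed
    then show ?thesis by (simp add: map_graph_def FW hW)
  qed
  moreover have hF: "inj_on h (gverts F)" using h_inj by (simp add: FW)
  ultimately obtain f where f: "inj_on f V" "map_graph f T = F"
    using map_graph_inverse[OF sF hF] by metis
  have tF: "tree_graph F" using map_graph_tree[OF tree f(1)] f(2) by simp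
  have iso: "T \<simeq>\<^sub>g F" using map_graph_iso[OF simple f(1)] f(2) by simp
  interpret F: tree F by unfold_locales (rule tF)
  have UF: "gedges U \<subseteq> gedges F"
  proof
    fix e assume "e \<in> gedges U"
    then obtain i j where ij: "i \<in> {1..n}" "j < k i"
      and "e = {(i, Center), (i, Mid j)} \<or> e = {(i, Mid j), (i, Tip j)}"
      unfolding U_def spiders_edge_iff by blast
    then show "e \<in> gedges F"
      using mt(1)[OF gM(1)[OF ij(2)]] mt(3)[OF gM(1)[OF ij(2)]] M_edges[OF gM(1)[OF ij(2)]]
        gM(2)[OF ij(2)] by (auto simp: F_edge)
  qed
  define A where "A = gedges F - gedges U"
  \<comment> \<open>The tree has \<open>card W - 1\<close> edges, the spiders have
    \<open>card W - n\<close>.\<close>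
  have card_A: "card A = n - 1"
  proof -
    have "card W = card (gedges U) + n"
      using card_spiders[of "{1..n}" k] by (simp add: W_def U_def)
    moreover have "card (gedges F) = card W - 1" using F.card_edges FW by simp
    moreover have "card A = card (gedges F) - card (gedges U)"
      unfolding A_def using UF F.finE finite_subset by (intro card_Diff_subset) blast+
    ultimately show ?thesis by simp
  qed
  have F_eq: "F = add_edges U A"
    using UF by (simp add: add_edges_def A_def prod_eq_iff FW W_def Un_absorb1)
  \<comment> \<open>An edge without a center has two covered ends, so its image belongs to
    \<open>M\<close>. It is then a leg and already an edge of a spider.\<close>
  have C1: "\<exists>i\<in>{1..n}. (i, Center) \<in> e" if e: "e \<in> A" for e
  proof (rule ccontr)
    assume no: "\<not> ?thesis"
    have eF: "e \<subseteq> W" "h ` e \<in> E" using e by (simp_all add: A_def F_edge)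
    have cov: "h p \<in> \<Union>M" if "p \<in> e" for p
    proof -
      obtain i x where p: "p = (i, x)" by (cases p)
      have "p \<in> W" using that eF(1) by blast
      show ?thesis
      proof (cases x)
        case Center
        then show ?thesis using no that p \<open>p \<in> W\<close> by auto
      next
        case (Mid j)
        then have "j < k i" using p \<open>p \<in> W\<close> by simp
        then show ?thesis using mtM(1)[OF gM(1)] gM(1) p Mid by (metis UnionI h(2))
      next
        case (Tip j)
        then have "j < k i" using p \<open>p \<in> W\<close> by simp
        then show ?thesis using mtM(2)[OF gM(1)] gM(1) p Tip by (metis UnionI h(3))
      qed
    qed
    have "e \<in> gedges F" using e by (simp add: A_def)
    then obtain p q where pq: "e = {p, q}" using simple_graph_edgeE[OF sF] by metis
    have "{h p, h q} \<in> E" using eF(2) pq by simp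
    moreover have "p \<in> e" "q \<in> e" using pq by simp_all
    ultimately have "{h p, h q} \<in> M" using covered_adj[OF cov cov] by metis
    then obtain i j where ij: "i \<in> {1..n}" "j < k i" "{h p, h q} = g i j" using leg_index by blast
    then have "h ` e = h ` {(i, Mid j), (i, Tip j)}" using mt(1)[OF gM(1)[OF ij(2)]] pq by simp
    then have "e = {(i, Mid j), (i, Tip j)}"
      using inj_on_image_eq_iff[OF h_inj eF(1), of "{(i, Mid j), (i, Tip j)}"] ij(1,2) by simp
    then have "e \<in> gedges U" using ij(1,2) unfolding U_def spiders_edge_iff by blast
    then show False using e by (simp add: A_def)
  qed
  have tips: "k i \<ge> 2 \<and> (\<exists>x\<in>gleaves (spider (k i)). \<exists>y\<in>gleaves (spider (k i)).
        x \<noteq> y \<and> gdegree F (i, x) = 1 \<and> gdegree F (i, y) = 1)" if i: "i \<in> {1..n}" for i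
  proof -
    obtain a a' b b' where ab: "leaf_leg T M own (c i) a a'" "leaf_leg T M own (c i) b b'"
      "{a, a'} \<noteq> {b, b'}" using legs[OF cC[OF i]] by blast
    have tip: "\<exists>j<k i. {a, a'} = g i j \<and> gdegree F (i, Tip j) = 1"
      if l: "leaf_leg T M own (c i) a a'" for a a'
    proof -
      have m: "{a, a'} \<in> M" "own {a, a'} = c i" "\<And>u. {a', u} \<in> E \<Longrightarrow> u = a"
        using l by (simp_all add: leaf_leg_def)
      then obtain i' j where ij: "i' \<in> {1..n}" "j < k i'" "{a, a'} = g i' j" using leg_index by blast
      then have "i' = i" using gM(2)[OF ij(2)] m(2) c_inj[OF ij(1) i] by simp
      then have j: "j < k i" "{a, a'} = g i j" using ij by simp_all
      \<comment> \<open>The orientation of the leg must agree with \<open>leaf_leg\<close>: the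
        middle vertex is adjacent to the uncovered \<open>c i\<close>, whereas the leaf
        \<open>a'\<close> is adjacent only to the covered \<open>a\<close>.\<close>
      have "mid (g i j) \<noteq> a'"
      proof
        assume "mid (g i j) = a'"
        then have "{a', c i} \<in> E" using mt(3)[OF gM(1)[OF j(1)]] gM(2)[OF j(1)]
          by (simp add: insert_commute)
        then have "c i = a" by (rule m(3))
        then show False using cC[OF i] m(1) by auto
      qed
      moreover have "{mid (g i j), tip (g i j)} = {a, a'}"
        using mt(1)[OF gM(1)[OF j(1)]] j(2) by simp
      ultimately have tm: "tip (g i j) = a'" "mid (g i j) = a" by (auto simp: doubleton_eq_iff)
      have "gdegree F (i, Tip j) = 1"
      proof (rule gdegree_1I)
        have "{(i, Mid j), (i, Tip j)} \<in> gedges U"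
          unfolding U_def spiders_edge_iff using i j(1) by blast
        then show "{(i, Mid j), (i, Tip j)} \<in> gedges F" using UF by blast
        fix e assume e: "e \<in> gedges F" "(i, Tip j) \<in> e"
        obtain q where q: "e = {(i, Tip j), q}" using simple_graph_edge_other[OF sF e] by metis
        have "e \<subseteq> W" "h ` e \<in> E" using e(1) by (simp_all add: F_edge)
        then have qW: "q \<in> W" "{a', h q} \<in> E" unfolding q by (simp_all add: tm)
        then have "h q = h (i, Mid j)" using m(3) tm by simp
        then have "q = (i, Mid j)" using inj_onD[OF h_inj _ qW(1)] i j(1) by simp
        then show "e = {(i, Mid j), (i, Tip j)}" using q by (simp add: insert_commute)
      qed simp
      then show ?thesis using j by blast
    qed
    obtain j where j: "j < k i" "{a, a'} = g i j" "gdegree F (i, Tip j) = 1" using tip[OF ab(1)] by blast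
    obtain j' where j': "j' < k i" "{b, b'} = g i j'" "gdegree F (i, Tip j') = 1"
      using tip[OF ab(2)] by blast
    have "j \<noteq> j'" using j(2) j'(2) ab(3) by auto
    then have "k i \<ge> 2" using j(1) j'(1) by linarith
    then show ?thesis using gleaves_spider[of "k i"] j j' \<open>j \<noteq> j'\<close> by auto
  qed
  have "F \<in> family_F"
    unfolding family_F_def mem_Collect_eq
  proof (intro exI[of _ n] exI[of _ k] exI[of _ A] conjI ballI)
    show "1 \<le> n" by (rule n)
    show "F = add_edges (spiders {1..n} k) A" using F_eq by (simp add: U_def)
    show "finite A" using F.finE by (simp add: A_def)
    show "card A = n - 1" by (rule card_A)
    show "A \<inter> gedges (spiders {1..n} k) = {}" unfolding A_def U_def by blast
    show "tree_graph F" by (rule tF)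
  next
    fix e assume "e \<in> A"
    then show "\<exists>i\<in>{1..n}. (i, Center) \<in> e" by (rule C1)
  next
    fix i assume i: "i \<in> {1..n}"
    show "2 \<le> k i" using tips[OF i] by (rule conjunct1)
    show "\<exists>x\<in>gleaves (spider (k i)). \<exists>y\<in>gleaves (spider (k i)).
        x \<noteq> y \<and> gdegree F (i, x) = 1 \<and> gdegree F (i, y) = 1"
      using tips[OF i] by (rule conjunct2)
  qed
  then show ?thesis using iso by blast
qed

end

section \<open>The paths on one and two vertices, and the equivalence\<close>

lemma path_graph_simple: "simple_graph (path_graph n)"
  by (auto simp: simple_graph_def path_graph_def)

lemma numbers_eq_if_single_edge:
  assumes G: "simple_graph G" and e: "gedges G \<subseteq> {e}"
  shows "\<rho>\<^sub>e\<^sup>o G = \<nu>\<^sub>I G"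
proof (rule eop_number_eq_induced_matching_number[OF G])
  show "induced_matching G (gedges G)" unfolding induced_matching_iff using e by blast
  show "card B \<le> card (gedges G)" if "eop_set G B" for B
    using that simple_graph_finite_edges[OF G] by (simp add: eop_set_def card_mono)
qed

lemma path_graph_edges: "gedges (path_graph 1) = {}" "gedges (path_graph 2) = {{0, 1}}"
  by (auto simp: path_graph_def)

context tree
begin

lemma iso_path_graph_1:
  assumes "V = {v}"
  shows "T \<simeq>\<^sub>g path_graph 1"
  unfolding graph_iso_def
proof (intro exI[of _ "\<lambda>_. 0"] conjI ballI)
  show "bij_betw (\<lambda>_. 0) V (gverts (path_graph 1))"
    using assms by (simp add: bij_betw_def path_graph_def lessThan_Suc)
  fix x y assume "x \<in> V" "y \<in> V"
  then have "{x, y} \<notin> E" using assms adj_neq[of x y] by auto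
  then show "{x, y} \<in> E \<longleftrightarrow> {0, 0} \<in> gedges (path_graph 1)" unfolding path_graph_edges by simp
qed

lemma iso_path_graph_2:
  assumes V: "V = {a, b}" and e: "{a, b} \<in> E"
  shows "T \<simeq>\<^sub>g path_graph 2"
  unfolding graph_iso_def
proof (intro exI[of _ "\<lambda>x. if x = a then 0 else 1"] conjI ballI)
  let ?f = "\<lambda>x. if x = a then 0 else (1 :: nat)"
  have ab: "a \<noteq> b" using adj_neq[OF e] .
  have "{..<2} = {0, 1 :: nat}" by auto
  then show "bij_betw ?f V (gverts (path_graph 2))"
    using V ab by (auto simp: bij_betw_def inj_on_def path_graph_def)
  fix x y assume xy: "x \<in> V" "y \<in> V"
  have no: "{a} \<notin> E" "{b} \<notin> E" using adj_neq[of a a] adj_neq[of b b] by auto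
  have "{b, a} \<in> E" using adj_sym[OF e] .
  then show "{x, y} \<in> E \<longleftrightarrow> {?f x, ?f y} \<in> gedges (path_graph 2)"
    using xy e no ab unfolding V path_graph_edges by (auto simp: doubleton_eq_iff)
qed

end

theorem corollary2p9:
  fixes T :: "'a ugraph"
  assumes "tree_graph T"
  shows "\<rho>\<^sub>e\<^sup>o T = \<nu>\<^sub>I T \<longleftrightarrow>
    (\<exists>F\<in>family_F. T \<simeq>\<^sub>g F) \<or> T \<simeq>\<^sub>g path_graph 1 \<or> T \<simeq>\<^sub>g path_graph 2"
proof -
  interpret tree T by unfold_locales (rule assms)
  show ?thesis
  proof
    assume eq: "\<rho>\<^sub>e\<^sup>o T = \<nu>\<^sub>I T"
    obtain M where M: "induced_matching T M" "card M = \<nu>\<^sub>I T"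
      using induced_matching_number_attained[OF simple] .
    interpret eop_extremal_tree T M
      using M card_le_eop_number[OF simple] eq by unfold_locales simp_all
    obtain r where r: "r \<in> V" using connected by (auto simp: connected_graph_def)
    \<comment> \<open>A lone vertex is \<open>P_1\<close>, and a matching that covers everything
      leads to \<open>P_2\<close>; otherwise there is a center to serve as root, together with a
      further vertex.\<close>
    consider v where "V = {v}" | "V - \<Union>M = {}" | c where "c \<in> V - \<Union>M" "V \<noteq> {c}" by blast
    then show "(\<exists>F\<in>family_F. T \<simeq>\<^sub>g F) \<or> T \<simeq>\<^sub>g path_graph 1 \<or> T \<simeq>\<^sub>g path_graph 2"
    proof cases
      case 1
      then show ?thesis using iso_path_graph_1 by simp
    next
      case 2
      then have "r \<in> \<Union>M" using r by blast
      then obtain s where s: "{r, s} \<in> M" by (rule partnerE)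
      \<comment> \<open>With every vertex covered, every edge of \<open>T\<close> belongs to the
        induced matching, so a walk from \<open>r\<close> never leaves the edge
        \<open>rs\<close>.\<close>
      have "x = r \<or> x = s" if "x \<in> V" for x
        using r that
      proof (induction rule: connected_induct)
        case (step y z)
        have "y \<in> V" "z \<in> V" using adj_verts[OF step(1)] by simp_all
        then have "{y, z} \<in> M" using covered_adj[OF _ _ step(1)] 2 by blast
        then show ?case
          using step(2) partner_unique[OF s, of z] partner_unique[of s r z] s
          by (auto simp: insert_commute)
      qed simp
      then have "V = {r, s}" using r adj_verts[OF M_edges[OF s]] by blast
      then show ?thesis using iso_path_graph_2 M_edges[OF s] by blast
    next
      case 3
      obtain own where own:
        "\<And>m. m \<in> M \<Longrightarrow> own m \<in> V - \<Union>M \<and> (\<exists>x\<in>m. {own m, x} \<in> E)"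
        "\<And>v. v \<in> V - \<Union>M \<Longrightarrow>
          \<exists>a a' b b'. leaf_leg T M own v a a' \<and> leaf_leg T M own v b b' \<and> {a, a'} \<noteq> {b, b'}"
        using leaf_legs_assignment[OF 3] by blast
      have "V - \<Union>M \<noteq> {}" using 3(1) by blast
      then have "\<exists>F\<in>family_F. T \<simeq>\<^sub>g F" using iso_family_F[of own] own by blast
      then show ?thesis by (rule disjI1)
    qed
  next
    assume "(\<exists>F\<in>family_F. T \<simeq>\<^sub>g F) \<or> T \<simeq>\<^sub>g path_graph 1 \<or> T \<simeq>\<^sub>g path_graph 2"
    then consider F where "F \<in> family_F" "T \<simeq>\<^sub>g F" | "T \<simeq>\<^sub>g path_graph 1" | "T \<simeq>\<^sub>g path_graph 2"
      by blast
    then show "\<rho>\<^sub>e\<^sup>o T = \<nu>\<^sub>I T"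
    proof cases
      case 1
      have "simple_graph F" using family_F_tree[OF 1(1)] by (simp add: tree_graph_def)
      then show ?thesis
        using graph_iso_numbers[OF simple _ 1(2)] family_F_numbers[OF 1(1)] by simp
    next
      case 2
      then show ?thesis
        using graph_iso_numbers[OF simple path_graph_simple 2]
          numbers_eq_if_single_edge[OF path_graph_simple, of 1] path_graph_edges(1) by simp
    next
      case 3
      then show ?thesis
        using graph_iso_numbers[OF simple path_graph_simple 3]
          numbers_eq_if_single_edge[OF path_graph_simple, of 2 "{0, 1}"] path_graph_edges(2) by simp
    qed
  qed
qed

end
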